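(* Let $p,q$ be relatively prime integers with $p>q\geq 1$ and let $M=\frac{p}{q}$. For each integer $m$ with $1\leq m\leq p-q$, let $\psi^m\in L^2(\mathbb{R})$ be defined by $$\hat{\psi}^m(\omega)=\begin{cases}\sqrt{q} & \text{if } (q+m-1)\frac{\pi}{q}\leq|\omega|<(q+m)\frac{\pi}{q},\\ 0 & \text{elsewhere.}\end{cases}$$ Then the set $\left\{\psi_{j,n}^m(x)=M^{-\frac{j}{2}}\psi^m(M^{-j}x-nq)\right\}_{j,n\in\mathbb{Z},\ 1\leq m\leq p-q}$ is an orthonormal basis of $L^2(\mathbb{R})$.
   Context: $L^2(\mathbb{R})$ carries the inner product $\langle f,g\rangle=\int_{-\infty}^{+\infty}f(x)\overline{g(x)}\,dx$. The Fourier transform is $\hat{f}(\omega)=\int_{-\infty}^{+\infty}f(x)e^{-i\omega x}\,dx$ (extended to $L^2(\mathbb{R})$), so that Parseval's formula reads $\langle f,g\rangle=\frac{1}{2\pi}\langle\hat f,\hat g\rangle$. *)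

theory Defs
  imports "HOL-Analysis.Analysis"
begin

text \<open>
  Elements of \<open>L\<^sup>2(\<real>)\<close> are represented by Borel functions \<open>real \<Rightarrow> complex\<close>; every
  almost-everywhere class has such a representative, and every notion below is
  invariant under almost-everywhere equality of Borel functions.
\<close>

definition L2 :: "(real \<Rightarrow> complex) set" where
  "L2 = {f. f \<in> borel_measurable lborel \<and> integrable lborel (\<lambda>x. (cmod (f x))\<^sup>2)}"

definition L2_inner :: "(real \<Rightarrow> complex) \<Rightarrow> (real \<Rightarrow> complex) \<Rightarrow> complex" where
  "L2_inner f g = (LINT x|lborel. f x * cnj (g x))"

definition L2_norm :: "(real \<Rightarrow> complex) \<Rightarrow> real" where
  "L2_norm f = sqrt (LINT x|lborel. (cmod (f x))\<^sup>2)"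

definition L2_tendsto :: "(nat \<Rightarrow> real \<Rightarrow> complex) \<Rightarrow> (real \<Rightarrow> complex) \<Rightarrow> bool" where
  "L2_tendsto F f \<longleftrightarrow>
     (\<forall>k. F k \<in> L2) \<and> f \<in> L2 \<and> (\<lambda>k. L2_norm (\<lambda>x. F k x - f x)) \<longlonglongrightarrow> 0"

definition fourier_L1 :: "(real \<Rightarrow> complex) \<Rightarrow> real \<Rightarrow> complex" where
  "fourier_L1 f \<omega> = (LINT x|lborel. f x * exp (- (\<i> * complex_of_real (\<omega> * x))))"

text \<open>
  \<open>g\<close> represents the Fourier transform of \<open>f \<in> L\<^sup>2(\<real>)\<close>: the continuous extension of
  \<open>fourier_L1\<close> from the dense subspace \<open>L\<^sup>1 \<inter> L\<^sup>2\<close>. This is a relation, since \<open>g\<close> is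
  determined only up to a null set.
\<close>

definition has_fourier_L2 :: "(real \<Rightarrow> complex) \<Rightarrow> (real \<Rightarrow> complex) \<Rightarrow> bool" where
  "has_fourier_L2 f g \<longleftrightarrow>
     (\<exists>F. (\<forall>k. integrable lborel (F k)) \<and> L2_tendsto F f \<and>
          L2_tendsto (\<lambda>k. fourier_L1 (F k)) g)"

text \<open>An orthonormal family in \<open>L\<^sup>2(\<real>)\<close> whose finite linear combinations are dense.\<close>

definition orthonormal_basis_L2 :: "'i set \<Rightarrow> ('i \<Rightarrow> real \<Rightarrow> complex) \<Rightarrow> bool" where
  "orthonormal_basis_L2 I e \<longleftrightarrow>
     (\<forall>i\<in>I. e i \<in> L2) \<and>
     (\<forall>i\<in>I. \<forall>k\<in>I. L2_inner (e i) (e k) = (if i = k then 1 else 0)) \<and>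
     (\<forall>f\<in>L2. \<forall>\<epsilon>>0. \<exists>A c. finite A \<and> A \<subseteq> I \<and>
        L2_norm (\<lambda>x. f x - (\<Sum>i\<in>A. c i * e i x)) < \<epsilon>)"

end

theory Submission
  imports Defs "HOL-Probability.Characteristic_Functions"
begin

text \<open>
  By Parseval's formula it suffices to show that the Fourier transforms of the wavelets are
  orthogonal of norm \<open>sqrt (2 * pi)\<close> and complete. With \<open>s = q * M powi j\<close> and \<open>k = q + m - 1\<close>, the
  transform of \<open>\<psi>\<^sub>j\<^sub>,\<^sub>n\<^sup>m\<close> is \<open>sqrt s * cis (- n * s * \<omega>)\<close> on the set where
  \<open>k * pi \<le> \<bar>s * \<omega>\<bar> < (k + 1) * pi\<close>. As \<open>k\<close> runs through \<open>q, \<dots>, p - 1\<close> and \<open>j\<close> through the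
  integers, these sets partition the nonzero reals, because \<open>p = q * M\<close>. The two intervals of such a
  band, translated by multiples of \<open>2 * pi\<close>, form one full period, so on each band orthogonality
  and completeness reduce to those of the exponentials on a period.
\<close>

section \<open>Square-integrable functions\<close>

text \<open>The transform on L2 is only a relation, given by limits of transforms of integrable
  functions. Completeness is therefore pulled back one function at a time: a given f is cut off to a
  bounded interval, which makes it integrable, so that its transform is given by the integral; this
  transform is approximated by the frequency-side family, and the norm identity carries the
  approximation back to f.

  The norm identity must come before it is known that the transform of an integrable f is
  square-integrable. Gaussian weights settle integrability and value together: as the weights
  increase to 1, the weighted energies have the finite limit \<open>2 * pi\<close> times the squared
  norm of f.

  The number q enters three times. Height \<open>sqrt q\<close> on a band of total length
  \<open>2 * pi / q\<close> gives squared norm \<open>2 * pi\<close>. Translations by multiples of q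
  become exponentials with integer frequency n in the variable \<open>s * \<omega>\<close>, in which
  the band ends are integer multiples of pi. And in that variable one level fills the moduli from
  \<open>q * pi\<close> to \<open>p * pi\<close>; this range has end-point ratio M, so the levels
  fit together, and it holds p - q bands, one for each generator.\<close>

lemma borel_measurable_cnj [measurable]: "cnj \<in> borel_measurable borel"
  by (intro borel_measurable_continuous_onI continuous_intros)

lemma L2_I:
  assumes "f \<in> borel_measurable borel" "integrable lborel (\<lambda>x. (cmod (f x))\<^sup>2)"
  shows "f \<in> L2"
  using assms by (simp add: L2_def)

lemma L2_measurable: "f \<in> L2 \<Longrightarrow> f \<in> borel_measurable borel"
  by (simp add: L2_def)

lemma L2_integrable: "f \<in> L2 \<Longrightarrow> integrable lborel (\<lambda>x. (cmod (f x))\<^sup>2)"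
  by (simp add: L2_def)

lemma L2_norm_nonneg: "L2_norm f \<ge> 0"
  by (simp add: L2_norm_def)

lemma L2_norm_power2: "(L2_norm f)\<^sup>2 = (LINT x|lborel. (cmod (f x))\<^sup>2)"
  by (simp add: L2_norm_def)

lemma L2_bound:
  assumes "g \<in> borel_measurable borel" "f \<in> L2" "\<And>x. cmod (g x) \<le> cmod (f x)"
  shows "g \<in> L2"
proof (rule L2_I[OF assms(1)], rule Bochner_Integration.integrable_bound[OF L2_integrable[OF assms(2)]])
  show "(\<lambda>x. (cmod (g x))\<^sup>2) \<in> borel_measurable lborel"
    using assms(1) by simp
  show "AE x in lborel. norm ((cmod (g x))\<^sup>2) \<le> norm ((cmod (f x))\<^sup>2)"
    using assms(3) by (auto intro!: power_mono)
qed

lemma L2_zero: "(\<lambda>x. 0) \<in> L2"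
  by (simp add: L2_def)

lemma L2_cmult: "f \<in> L2 \<Longrightarrow> (\<lambda>x. c * f x) \<in> L2"
  by (auto simp: L2_def norm_mult power_mult_distrib intro!: borel_measurable_times)

lemma L2_add:
  assumes "f \<in> L2" "g \<in> L2"
  shows "(\<lambda>x. f x + g x) \<in> L2"
proof (rule L2_I)
  have [measurable]: "f \<in> borel_measurable borel" "g \<in> borel_measurable borel"
    using assms by (auto dest: L2_measurable)
  show "(\<lambda>x. f x + g x) \<in> borel_measurable borel"
    by measurable
  have "integrable lborel (\<lambda>x. 2 * (cmod (f x))\<^sup>2 + 2 * (cmod (g x))\<^sup>2)"
    using assms by (simp add: L2_integrable)
  then show "integrable lborel (\<lambda>x. (cmod (f x + g x))\<^sup>2)"
  proof (rule Bochner_Integration.integrable_bound)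
    show "AE x in lborel. norm ((cmod (f x + g x))\<^sup>2)
        \<le> norm (2 * (cmod (f x))\<^sup>2 + 2 * (cmod (g x))\<^sup>2)"
    proof (rule AE_I2)
      fix x
      have "(cmod (f x + g x))\<^sup>2 \<le> (cmod (f x) + cmod (g x))\<^sup>2"
        by (intro power_mono norm_triangle_ineq) simp
      also have "\<dots> \<le> 2 * (cmod (f x))\<^sup>2 + 2 * (cmod (g x))\<^sup>2"
        using sum_squares_ge_zero[of "cmod (f x) - cmod (g x)" 0]
        by (simp add: power2_eq_square algebra_simps)
      finally show "norm ((cmod (f x + g x))\<^sup>2) \<le> norm (2 * (cmod (f x))\<^sup>2 + 2 * (cmod (g x))\<^sup>2)"
        by simp
    qed
  qed simp
qed

lemma L2_diff: "f \<in> L2 \<Longrightarrow> g \<in> L2 \<Longrightarrow> (\<lambda>x. f x - g x) \<in> L2"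
  using L2_add[of f "\<lambda>x. (-1) * g x"] L2_cmult[of g "-1"] by simp

lemma L2_sum: "(\<And>i. i \<in> A \<Longrightarrow> f i \<in> L2) \<Longrightarrow> (\<lambda>x. \<Sum>i\<in>A. f i x) \<in> L2"
  by (induction A rule: infinite_finite_induct) (auto intro: L2_zero L2_add)

lemma L2_norm_cmult: "L2_norm (\<lambda>x. c * f x) = cmod c * L2_norm f"
  by (simp add: L2_norm_def norm_mult power_mult_distrib real_sqrt_mult)

lemma L2_norm_minus_commute: "L2_norm (\<lambda>x. f x - g x) = L2_norm (\<lambda>x. g x - f x)"
  by (simp add: L2_norm_def norm_minus_commute)

lemma L2_integrable_norm_mult:
  assumes "f \<in> L2" "g \<in> L2"
  shows "integrable lborel (\<lambda>x. cmod (f x) * cmod (g x))"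
proof -
  have [measurable]: "f \<in> borel_measurable borel" "g \<in> borel_measurable borel"
    using assms by (auto dest: L2_measurable)
  have "integrable lborel (\<lambda>x. (cmod (f x))\<^sup>2 + (cmod (g x))\<^sup>2)"
    using assms by (simp add: L2_integrable)
  then show ?thesis
  proof (rule Bochner_Integration.integrable_bound)
    show "AE x in lborel. norm (cmod (f x) * cmod (g x))
        \<le> norm ((cmod (f x))\<^sup>2 + (cmod (g x))\<^sup>2)"
    proof (rule AE_I2)
      fix x
      have "2 * (cmod (f x) * cmod (g x)) \<le> (cmod (f x))\<^sup>2 + (cmod (g x))\<^sup>2"
        using sum_squares_bound[of "cmod (f x)" "cmod (g x)"] by simp
      moreover have "0 \<le> cmod (f x) * cmod (g x)"
        by simp
      ultimately have "cmod (f x) * cmod (g x) \<le> (cmod (f x))\<^sup>2 + (cmod (g x))\<^sup>2"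
        by linarith
      then show "norm (cmod (f x) * cmod (g x)) \<le> norm ((cmod (f x))\<^sup>2 + (cmod (g x))\<^sup>2)"
        by simp
    qed
  qed simp
qed

lemma L2_integrable_mult:
  assumes "f \<in> L2" "g \<in> L2"
  shows "integrable lborel (\<lambda>x. f x * cnj (g x))"
proof -
  have [measurable]: "f \<in> borel_measurable borel" "g \<in> borel_measurable borel"
    using assms by (auto dest: L2_measurable)
  have "(\<lambda>x. f x * cnj (g x)) \<in> borel_measurable lborel"
    by measurable
  then show ?thesis
    by (rule Bochner_Integration.integrable_bound[OF L2_integrable_norm_mult[OF assms]])
       (auto simp: norm_mult)
qed

text \<open>The moduli stand inside the integral because this stronger form also supplies the
  absolute bounds for Fubini's theorem later on.\<close>

lemma L2_Cauchy_Schwarz: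
  assumes "f \<in> L2" "g \<in> L2"
  shows "(LINT x|lborel. cmod (f x) * cmod (g x)) \<le> L2_norm f * L2_norm g"
proof -
  define a where "a = L2_norm f"
  define b where "b = L2_norm g"
  define c where "c = (LINT x|lborel. cmod (f x) * cmod (g x))"
  have a: "(LINT x|lborel. (cmod (f x))\<^sup>2) = a\<^sup>2" and b: "(LINT x|lborel. (cmod (g x))\<^sup>2) = b\<^sup>2"
    by (simp_all add: a_def b_def L2_norm_power2)
  have ab: "a \<ge> 0" "b \<ge> 0"
    by (simp_all add: a_def b_def L2_norm_nonneg)
  \<comment> \<open>The free weights s and t replace the usual normalisation of f and g; s = b and t
    = a give the claim when both norms are positive.\<close>
  have key: "2 * s * t * c \<le> s\<^sup>2 * a\<^sup>2 + t\<^sup>2 * b\<^sup>2" for s t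
  proof -
    have "2 * s * t * c = (LINT x|lborel. 2 * s * t * (cmod (f x) * cmod (g x)))"
      by (simp add: c_def)
    also have "\<dots> \<le> (LINT x|lborel. s\<^sup>2 * (cmod (f x))\<^sup>2 + t\<^sup>2 * (cmod (g x))\<^sup>2)"
    proof (rule integral_mono)
      fix x
      show "2 * s * t * (cmod (f x) * cmod (g x)) \<le> s\<^sup>2 * (cmod (f x))\<^sup>2 + t\<^sup>2 * (cmod (g x))\<^sup>2"
        using sum_squares_bound[of "s * cmod (f x)" "t * cmod (g x)"]
        by (simp add: power_mult_distrib algebra_simps)
    qed (use assms in \<open>auto simp: L2_integrable L2_integrable_norm_mult\<close>)
    also have "\<dots> = s\<^sup>2 * a\<^sup>2 + t\<^sup>2 * b\<^sup>2"
      using assms by (simp add: L2_integrable a b)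
    finally show ?thesis .
  qed
  have "c \<le> a * b"
  proof (cases "a = 0 \<or> b = 0")
    case False
    then have "2 * b * a * c \<le> 2 * b * a * (a * b)"
      using key[of b a] by (simp add: power2_eq_square algebra_simps)
    then show ?thesis
      using False ab by (simp add: mult_le_cancel_left)
  next
    case True
    show ?thesis
    proof (rule ccontr)
      assume "\<not> c \<le> a * b"
      with True have c: "c > 0" by auto
      show False
      proof (cases "a = 0")
        case True
        \<comment> \<open>With a = 0 and t = 1 the inequality reads
          \<open>2 * s * c \<le> b\<^sup>2\<close>; this s makes the left side
          \<open>b\<^sup>2 + 1\<close>.\<close>
        from key[of "(b\<^sup>2 + 1) / (2 * c)" 1] True c show False
          by simp
      next
        case False
        with \<open>a = 0 \<or> b = 0\<close> have "b = 0" by simp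
        with key[of 1 "(a\<^sup>2 + 1) / (2 * c)"] c show False
          by simp
      qed
    qed
  qed
  then show ?thesis
    by (simp add: a_def b_def c_def)
qed

lemma L2_inner_bound:
  assumes "f \<in> L2" "g \<in> L2"
  shows "cmod (L2_inner f g) \<le> L2_norm f * L2_norm g"
proof -
  have "cmod (L2_inner f g) \<le> (LINT x|lborel. cmod (f x * cnj (g x)))"
    unfolding L2_inner_def by (rule integral_norm_bound)
  also have "\<dots> = (LINT x|lborel. cmod (f x) * cmod (g x))"
    by (simp add: norm_mult)
  finally show ?thesis
    using L2_Cauchy_Schwarz[OF assms] by simp
qed

lemma L2_norm_add_power2:
  assumes "f \<in> L2" "g \<in> L2"
  shows "(L2_norm (\<lambda>x. f x + g x))\<^sup>2 = (L2_norm f)\<^sup>2 + 2 * Re (L2_inner f g) + (L2_norm g)\<^sup>2"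
proof -
  have eq: "(cmod (f x + g x))\<^sup>2 = (cmod (f x))\<^sup>2 + 2 * Re (f x * cnj (g x)) + (cmod (g x))\<^sup>2" for x
    unfolding cmod_power2 by (simp add: power2_eq_square algebra_simps)
  have "(L2_norm (\<lambda>x. f x + g x))\<^sup>2
      = (LINT x|lborel. (cmod (f x))\<^sup>2 + 2 * Re (f x * cnj (g x)) + (cmod (g x))\<^sup>2)"
    unfolding L2_norm_power2 eq ..
  also have "\<dots> = (LINT x|lborel. (cmod (f x))\<^sup>2) + 2 * (LINT x|lborel. Re (f x * cnj (g x)))
      + (LINT x|lborel. (cmod (g x))\<^sup>2)"
  proof -
    have "integrable lborel (\<lambda>x. Re (f x * cnj (g x)))"
      using L2_integrable_mult[OF assms] by (rule integrable_Re)
    then show ?thesis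
      using assms by (subst Bochner_Integration.integral_add; 
          (subst Bochner_Integration.integral_add)?) (auto simp: L2_integrable simp del: times_complex.sel)
  qed
  also have "(LINT x|lborel. Re (f x * cnj (g x))) = Re (L2_inner f g)"
    unfolding L2_inner_def using L2_integrable_mult[OF assms] by (rule integral_Re)
  finally show ?thesis
    by (simp add: L2_norm_power2)
qed

lemma L2_norm_triangle:
  assumes "f \<in> L2" "g \<in> L2"
  shows "L2_norm (\<lambda>x. f x + g x) \<le> L2_norm f + L2_norm g"
proof (rule power2_le_imp_le)
  have "Re (L2_inner f g) \<le> L2_norm f * L2_norm g"
    using L2_inner_bound[OF assms] complex_Re_le_cmod order_trans by blast
  then show "(L2_norm (\<lambda>x. f x + g x))\<^sup>2 \<le> (L2_norm f + L2_norm g)\<^sup>2"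
    unfolding L2_norm_add_power2[OF assms] by (simp add: power2_sum)
qed (simp add: L2_norm_nonneg)

lemma L2_norm_triangle_diff:
  assumes "f \<in> L2" "g \<in> L2" "h \<in> L2"
  shows "L2_norm (\<lambda>x. f x - h x) \<le> L2_norm (\<lambda>x. f x - g x) + L2_norm (\<lambda>x. g x - h x)"
  using L2_norm_triangle[OF L2_diff[OF assms(1,2)] L2_diff[OF assms(2,3)]] by simp

lemma L2_norm_diff_bound:
  assumes "f \<in> L2" "g \<in> L2"
  shows "\<bar>L2_norm f - L2_norm g\<bar> \<le> L2_norm (\<lambda>x. f x - g x)"
proof -
  have "L2_norm f \<le> L2_norm (\<lambda>x. f x - g x) + L2_norm g"
    using L2_norm_triangle[OF L2_diff[OF assms] assms(2)] by simp
  moreover have "L2_norm g \<le> L2_norm (\<lambda>x. g x - f x) + L2_norm f"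
    using L2_norm_triangle[OF L2_diff[OF assms(2,1)] assms(1)] by simp
  ultimately show ?thesis
    using L2_norm_minus_commute[of f g] by linarith
qed

section \<open>Convergence in the L2 norm\<close>

lemma L2_tendsto_norm:
  assumes "L2_tendsto F f"
  shows "(\<lambda>k. L2_norm (F k)) \<longlonglongrightarrow> L2_norm f"
proof -
  have "(\<lambda>k. L2_norm (F k) - L2_norm f) \<longlonglongrightarrow> 0"
  proof (rule tendsto_rabs_zero_cancel, rule tendsto_sandwich[OF _ _ tendsto_const])
    show "\<forall>\<^sub>F k in sequentially. 0 \<le> \<bar>L2_norm (F k) - L2_norm f\<bar>"
      by simp
    show "\<forall>\<^sub>F k in sequentially. \<bar>L2_norm (F k) - L2_norm f\<bar> \<le> L2_norm (\<lambda>x. F k x - f x)"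
      using assms by (intro always_eventually allI L2_norm_diff_bound) (auto simp: L2_tendsto_def)
    show "(\<lambda>k. L2_norm (\<lambda>x. F k x - f x)) \<longlonglongrightarrow> 0"
      using assms by (simp add: L2_tendsto_def)
  qed
  then show ?thesis
    using Lim_null by blast
qed

lemma L2_tendsto_add:
  assumes "L2_tendsto F f" "L2_tendsto G g"
  shows "L2_tendsto (\<lambda>k x. F k x + G k x) (\<lambda>x. f x + g x)"
proof -
  have F: "F k \<in> L2" "f \<in> L2" "G k \<in> L2" "g \<in> L2" for k
    using assms by (auto simp: L2_tendsto_def)
  have "(\<lambda>k. L2_norm (\<lambda>x. (F k x + G k x) - (f x + g x))) \<longlonglongrightarrow> 0"
  proof (rule tendsto_sandwich[OF _ _ tendsto_const])
    show "\<forall>\<^sub>F k in sequentially. L2_norm (\<lambda>x. (F k x + G k x) - (f x + g x))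
        \<le> L2_norm (\<lambda>x. F k x - f x) + L2_norm (\<lambda>x. G k x - g x)"
    proof (intro always_eventually allI)
      fix k
      show "L2_norm (\<lambda>x. (F k x + G k x) - (f x + g x))
        \<le> L2_norm (\<lambda>x. F k x - f x) + L2_norm (\<lambda>x. G k x - g x)"
        using L2_norm_triangle[OF L2_diff[OF F(1,2)] L2_diff[OF F(3,4)], of k k]
        by (simp add: algebra_simps)
    qed
    show "(\<lambda>k. L2_norm (\<lambda>x. F k x - f x) + L2_norm (\<lambda>x. G k x - g x)) \<longlonglongrightarrow> 0"
      using assms tendsto_add[of "\<lambda>k. L2_norm (\<lambda>x. F k x - f x)" 0 sequentially "\<lambda>k. L2_norm (\<lambda>x. G k x - g x)" 0]
      by (simp add: L2_tendsto_def)
  qed (simp add: L2_norm_nonneg)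
  then show ?thesis
    using F by (simp add: L2_tendsto_def L2_add)
qed

lemma L2_tendsto_cmult:
  assumes "L2_tendsto F f"
  shows "L2_tendsto (\<lambda>k x. c * F k x) (\<lambda>x. c * f x)"
proof -
  have "(\<lambda>k. L2_norm (\<lambda>x. c * F k x - c * f x)) = (\<lambda>k. cmod c * L2_norm (\<lambda>x. F k x - f x))"
    by (simp flip: L2_norm_cmult add: algebra_simps)
  then show ?thesis
    using assms tendsto_mult_right_zero[of "\<lambda>k. L2_norm (\<lambda>x. F k x - f x)" sequentially "cmod c"]
    by (simp add: L2_tendsto_def L2_cmult)
qed

text \<open>Replacing g by \<i> g turns the imaginary part of the inner product into a real part, so
  the norms of four functions determine it. Any linear map that scales norms by a constant thus
  scales inner products by its square.\<close>

lemma L2_inner_polarization: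
  assumes "f \<in> L2" "g \<in> L2"
  shows "L2_inner f g = complex_of_real (((L2_norm (\<lambda>x. f x + g x))\<^sup>2 - (L2_norm f)\<^sup>2 - (L2_norm g)\<^sup>2) / 2)
    + \<i> * complex_of_real (((L2_norm (\<lambda>x. f x + \<i> * g x))\<^sup>2 - (L2_norm f)\<^sup>2 - (L2_norm g)\<^sup>2) / 2)"
proof -
  have "L2_inner f (\<lambda>x. \<i> * g x) = - \<i> * L2_inner f g"
    by (simp add: L2_inner_def algebra_simps flip: integral_mult_right_zero)
  then have "Re (L2_inner f (\<lambda>x. \<i> * g x)) = Im (L2_inner f g)"
    by simp
  then show ?thesis
    unfolding L2_norm_add_power2[OF assms] L2_norm_add_power2[OF assms(1) L2_cmult[OF assms(2)]]
    by (simp add: L2_norm_cmult complex_eq_iff)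
qed

lemma L2_tendstoI_dominated:
  assumes "\<And>k. F k \<in> borel_measurable borel" "f \<in> borel_measurable borel" "w \<in> L2"
    and "AE x in lborel. (\<lambda>k. F k x) \<longlonglongrightarrow> f x"
    and "\<And>k x. cmod (F k x) \<le> cmod (w x)" "\<And>x. cmod (f x) \<le> cmod (w x)"
  shows "L2_tendsto F f"
proof -
  note [measurable] = assms(1,2)
  have "(\<lambda>k. LINT x|lborel. (cmod (F k x - f x))\<^sup>2) \<longlonglongrightarrow> (LINT x::real|lborel. (0::real))"
  proof (rule integral_dominated_convergence[where w = "\<lambda>x. 4 * (cmod (w x))\<^sup>2"])
    show "integrable lborel (\<lambda>x. 4 * (cmod (w x))\<^sup>2)"
      using assms(3) by (simp add: L2_integrable)
    show "AE x in lborel. (\<lambda>k. (cmod (F k x - f x))\<^sup>2) \<longlonglongrightarrow> 0"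
      using assms(4)
    proof eventually_elim
      case (elim x)
      then show ?case
        using tendsto_power[OF tendsto_norm[OF LIM_zero[OF elim]], of 2] by simp
    qed
    show "AE x in lborel. norm ((cmod (F k x - f x))\<^sup>2) \<le> 4 * (cmod (w x))\<^sup>2" for k
    proof (rule AE_I2)
      fix x
      have "cmod (F k x - f x) \<le> 2 * cmod (w x)"
        using norm_triangle_ineq4[of "F k x" "f x"] assms(5)[of k x] assms(6)[of x] by linarith
      then have "(cmod (F k x - f x))\<^sup>2 \<le> (2 * cmod (w x))\<^sup>2"
        by (intro power_mono) auto
      then show "norm ((cmod (F k x - f x))\<^sup>2) \<le> 4 * (cmod (w x))\<^sup>2"
        by (simp add: power_mult_distrib)
    qed
  qed simp_all
  then have "(\<lambda>k. L2_norm (\<lambda>x. F k x - f x)) \<longlonglongrightarrow> 0"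
    using tendsto_real_sqrt by (fastforce simp: L2_norm_def)
  moreover have "F k \<in> L2" "f \<in> L2" for k
    using L2_bound assms by blast+
  ultimately show ?thesis
    by (simp add: L2_tendsto_def)
qed

lemma L2_tendsto_approx:
  assumes "L2_tendsto F f" "\<epsilon> > 0"
  obtains k where "F k \<in> L2" "L2_norm (\<lambda>x. f x - F k x) < \<epsilon>"
proof -
  have "(\<lambda>k. L2_norm (\<lambda>x. F k x - f x)) \<longlonglongrightarrow> 0"
    using assms(1) by (simp add: L2_tendsto_def)
  from order_tendstoD(2)[OF this assms(2)] obtain k where "L2_norm (\<lambda>x. F k x - f x) < \<epsilon>"
    by (auto simp: eventually_sequentially)
  then show thesis
    using that[of k] assms(1) by (simp add: L2_norm_minus_commute[of f] L2_tendsto_def)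
qed

lemma L2_affine:
  assumes "f \<in> L2" "a \<noteq> 0"
  shows "(\<lambda>x. f (t + a * x)) \<in> L2"
proof (rule L2_I)
  have [measurable]: "f \<in> borel_measurable borel"
    using assms by (auto dest: L2_measurable)
  show "(\<lambda>x. f (t + a * x)) \<in> borel_measurable borel"
    by measurable
  show "integrable lborel (\<lambda>x. (cmod (f (t + a * x)))\<^sup>2)"
    using lborel_integrable_real_affine[OF L2_integrable[OF assms(1)] assms(2), of t] .
qed

lemma L2_norm_affine:
  assumes "a \<noteq> 0"
  shows "L2_norm (\<lambda>x. f (t + a * x)) = L2_norm f / sqrt \<bar>a\<bar>"
proof -
  have "(LINT x|lborel. (cmod (f x))\<^sup>2) = \<bar>a\<bar> * (LINT x|lborel. (cmod (f (t + a * x)))\<^sup>2)"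
    using lborel_integral_real_affine[OF assms, of "\<lambda>x. (cmod (f x))\<^sup>2" t] by simp
  then show ?thesis
    using assms by (simp add: L2_norm_def real_sqrt_mult)
qed

lemma L2_tendsto_affine:
  assumes "L2_tendsto F f" "a \<noteq> 0"
  shows "L2_tendsto (\<lambda>k x. F k (t + a * x)) (\<lambda>x. f (t + a * x))"
proof -
  have "(\<lambda>k. L2_norm (\<lambda>x. F k x - f x) / sqrt \<bar>a\<bar>) \<longlonglongrightarrow> 0"
    using assms(1) tendsto_divide_zero[of "\<lambda>k. L2_norm (\<lambda>x. F k x - f x)"]
    by (simp add: L2_tendsto_def)
  then have "(\<lambda>k. L2_norm (\<lambda>x. F k (t + a * x) - f (t + a * x))) \<longlonglongrightarrow> 0"
    using L2_norm_affine[OF assms(2), of "\<lambda>x. F _ x - f x" t] by simp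
  then show ?thesis
    using assms by (simp add: L2_tendsto_def L2_affine)
qed

section \<open>Density of continuous functions and continuity of translations\<close>

lemma L2_bounded_support:
  assumes "f \<in> borel_measurable borel" "\<And>x. cmod (f x) \<le> B" "\<And>x. x \<notin> {a..b} \<Longrightarrow> f x = 0"
  shows "f \<in> L2"
proof (rule L2_bound[OF assms(1), of "\<lambda>x. complex_of_real (B * indicator {a..b} x)"])
  have "integrable lborel (\<lambda>x. B\<^sup>2 * indicator {a..b} x :: real)"
    by (intro integrable_mult_right integrable_real_indicator) (auto simp: emeasure_lborel_Icc_eq)
  moreover have "(\<lambda>x. B\<^sup>2 * indicator {a..b} x :: real) = (\<lambda>x. (cmod (complex_of_real (B * indicator {a..b} x)))\<^sup>2)"
    by (auto simp: indicator_def)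
  ultimately show "(\<lambda>x. complex_of_real (B * indicator {a..b} x)) \<in> L2"
    by (intro L2_I) (simp, metis)
  show "cmod (f x) \<le> cmod (complex_of_real (B * indicator {a..b} x))" for x
    using assms(2)[of x] assms(3)[of x] by (auto simp: indicator_def simp del: norm_le_zero_iff)
qed

lemma L2_approx_bounded:
  assumes "f \<in> L2" "\<epsilon> > 0"
  obtains k :: nat where "(\<lambda>x. if cmod (f x) \<le> real k then f x else 0) \<in> L2"
    "L2_norm (\<lambda>x. f x - (if cmod (f x) \<le> real k then f x else 0)) < \<epsilon>"
proof -
  have [measurable]: "f \<in> borel_measurable borel"
    using assms by (auto dest: L2_measurable)
  have "L2_tendsto (\<lambda>k x. if cmod (f x) \<le> real k then f x else 0) f"
  proof (rule L2_tendstoI_dominated[where w = f])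
    show "AE x in lborel. (\<lambda>k. if cmod (f x) \<le> real k then f x else 0) \<longlonglongrightarrow> f x"
    proof (intro AE_I2 tendsto_eventually)
      fix x
      obtain N where "cmod (f x) \<le> real N"
        using real_arch_simple by blast
      then show "\<forall>\<^sub>F k in sequentially. (if cmod (f x) \<le> real k then f x else 0) = f x"
        by (intro eventually_sequentiallyI[of N]) auto
    qed
  qed (use assms in auto)
  from L2_tendsto_approx[OF this assms(2)] that show thesis
    by metis
qed

lemma L2_approx_support:
  assumes "f \<in> L2" "\<epsilon> > 0"
  obtains k :: nat where "(\<lambda>x. if \<bar>x\<bar> < real k then f x else 0) \<in> L2"
    "L2_norm (\<lambda>x. f x - (if \<bar>x\<bar> < real k then f x else 0)) < \<epsilon>"
proof -
  have [measurable]: "f \<in> borel_measurable borel"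
    using assms by (auto dest: L2_measurable)
  have "L2_tendsto (\<lambda>k x. if \<bar>x\<bar> < real k then f x else 0) f"
  proof (rule L2_tendstoI_dominated[where w = f])
    show "AE x in lborel. (\<lambda>k. if \<bar>x\<bar> < real k then f x else 0) \<longlonglongrightarrow> f x"
    proof (intro AE_I2 tendsto_eventually)
      fix x :: real
      obtain N where "\<bar>x\<bar> < real N"
        using reals_Archimedean2 by blast
      then show "\<forall>\<^sub>F k in sequentially. (if \<bar>x\<bar> < real k then f x else 0) = f x"
        by (intro eventually_sequentiallyI[of N]) auto
    qed
  qed (use assms in auto)
  from L2_tendsto_approx[OF this assms(2)] that show thesis
    by metis
qed

text \<open>After truncating the values of f, measurability gives continuous functions that converge
  almost everywhere, but with no control of size or support. Clipping the values and multiplying by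
  a cutoff restores both without changing the limit, and dominated convergence applies. The interval
  is open so that the cutoffs can be continuous, vanish outside it and still tend to 1 at each of
  its points.\<close>

lemma L2_approx_continuous:
  assumes "f \<in> L2" "\<And>x. x \<notin> {a<..<b} \<Longrightarrow> f x = 0" "\<epsilon> > 0"
  obtains c B where "continuous_on UNIV c" "c \<in> L2" "\<And>x. x \<notin> {a<..<b} \<Longrightarrow> c x = 0"
    "\<And>x. cmod (c x) \<le> B" "L2_norm (\<lambda>x. f x - c x) < \<epsilon>"
proof -
  obtain k where k: "(\<lambda>x. if cmod (f x) \<le> real k then f x else 0) \<in> L2"
    "L2_norm (\<lambda>x. f x - (if cmod (f x) \<le> real k then f x else 0)) < \<epsilon> / 2"
    using L2_approx_bounded[OF assms(1), of "\<epsilon> / 2"] assms(3) by auto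
  define h where "h = (\<lambda>x. if cmod (f x) \<le> real k then f x else 0)"
  \<comment> \<open>The added 1 keeps B positive even for k = 0, so the clipping map below is well
    defined and continuous.\<close>
  define B where "B = real k + 1"
  have B: "B > 0" "cmod (h x) \<le> B" for x
    by (auto simp: B_def h_def)
  have h: "h \<in> L2" "L2_norm (\<lambda>x. f x - h x) < \<epsilon> / 2" "\<And>x. x \<notin> {a<..<b} \<Longrightarrow> h x = 0"
    using k assms(2) by (auto simp: h_def)
  have [measurable]: "h \<in> borel_measurable borel"
    using h by (auto dest: L2_measurable)
  have "h measurable_on UNIV"
    by (rule lebesgue_measurable_imp_measurable_on) (auto intro: measurable_completion)
  then obtain N g where N: "negligible N" and g: "\<And>n. continuous_on UNIV (g n)"
    and lim: "\<And>x. x \<notin> N \<Longrightarrow> (\<lambda>n. g n x) \<longlonglongrightarrow> h x"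
    unfolding measurable_on_def by auto
  \<comment> \<open>Radial retraction onto the disc of radius B; it fixes all values of h.\<close>
  define clip where "clip = (\<lambda>z. complex_of_real (B / max B (cmod z)) * z)"
  \<comment> \<open>A trapezoid that rises with slope n from both ends of the interval and is capped
    at 1; at a point at distance d from the complement it equals 1 once n exceeds 1 / d.\<close>
  define \<theta> where "\<theta> = (\<lambda>n x. min 1 (real n * max 0 (min (x - a) (b - x))))"
  define c where "c = (\<lambda>n x. complex_of_real (\<theta> n x) * clip (g n x))"
  have clip_cont: "continuous_on UNIV clip"
    unfolding clip_def using B(1) by (intro continuous_intros) auto
  have clip_bound: "cmod (clip z) \<le> B" for z
  proof -
    have "B / max B (cmod z) * cmod z \<le> B"
      using B(1) by (simp add: pos_divide_le_eq mult_left_mono)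
    moreover have "max B (cmod z) > 0"
      using B(1) by simp
    ultimately show ?thesis
      using B(1) by (simp add: clip_def norm_mult norm_divide)
  qed
  have clip_id: "clip z = z" if "cmod z \<le> B" for z
    using that B(1) by (simp add: clip_def max_def)
  have \<theta>: "0 \<le> \<theta> n x" "\<theta> n x \<le> 1" for n x
    by (auto simp: \<theta>_def)
  have \<theta>_0: "\<theta> n x = 0" if "x \<notin> {a<..<b}" for n x
    using that by (auto simp: \<theta>_def)
  have \<theta>_cont: "continuous_on UNIV (\<theta> n)" for n
    unfolding \<theta>_def by (intro continuous_intros)
  have c_cont: "continuous_on UNIV (c n)" for n
    unfolding c_def
    by (intro continuous_intros \<theta>_cont continuous_on_compose2[OF clip_cont] g) auto
  have c_bound: "cmod (c n x) \<le> B" for n x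
  proof -
    have "\<theta> n x * cmod (clip (g n x)) \<le> 1 * B"
      using \<theta> clip_bound by (intro mult_mono) auto
    then show ?thesis
      using \<theta>[of n x] by (simp add: c_def norm_mult)
  qed
  have c_0: "c n x = 0" if "x \<notin> {a<..<b}" for n x
    using \<theta>_0[OF that] by (simp add: c_def)
  have "L2_tendsto c h"
  proof (rule L2_tendstoI_dominated[where w = "\<lambda>x. complex_of_real (B * indicator {a..b} x)"])
    show "c n \<in> borel_measurable borel" for n
      using c_cont by (rule borel_measurable_continuous_onI)
    show "(\<lambda>x. complex_of_real (B * indicator {a..b} x)) \<in> L2"
      by (rule L2_bounded_support[of _ B a b]) (use B in \<open>auto simp: indicator_def\<close>)
    show "cmod (c n x) \<le> cmod (complex_of_real (B * indicator {a..b} x))" for n x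
      using c_bound[of n x] c_0[of x n] B by (cases "x \<in> {a<..<b}") (auto simp: norm_mult)
    show "cmod (h x) \<le> cmod (complex_of_real (B * indicator {a..b} x))" for x
      using B(2)[of x] h(3)[of x] B(1) by (cases "x \<in> {a<..<b}") (auto simp: norm_mult)
    have "AE x in lebesgue. x \<notin> N"
      using N by (intro AE_not_in) (simp add: negligible_iff_null_sets)
    then have "AE x in lborel. x \<notin> N"
      by (simp add: AE_completion_iff)
    then show "AE x in lborel. (\<lambda>n. c n x) \<longlonglongrightarrow> h x"
    proof eventually_elim
      case (elim x)
      show ?case
      proof (cases "x \<in> {a<..<b}")
        case False
        then show ?thesis
          using c_0 h(3) by simp
      next
        case True
        have "isCont clip (h x)"
          using clip_cont by (simp add: continuous_on_eq_continuous_at)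
        then have "(\<lambda>n. clip (g n x)) \<longlonglongrightarrow> clip (h x)"
          using lim[OF elim] by (rule isCont_tendsto_compose)
        moreover have "(\<lambda>n. complex_of_real (\<theta> n x)) \<longlonglongrightarrow> 1"
        proof (rule tendsto_eventually)
          define d where "d = min (x - a) (b - x)"
          have "d > 0"
            using True by (simp add: d_def)
          then obtain M where M: "1 / d < real M"
            using reals_Archimedean2 by blast
          have "\<theta> n x = 1" if "n \<ge> M" for n
          proof -
            have "1 / d < real n"
              using M that by linarith
            then have "1 \<le> real n * max 0 d"
              using \<open>d > 0\<close> by (simp add: divide_less_eq)
            then show ?thesis
              by (simp add: \<theta>_def d_def)
          qed
          then show "\<forall>\<^sub>F n in sequentially. complex_of_real (\<theta> n x) = 1"
            by (intro eventually_sequentiallyI[of M]) simp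
        qed
        ultimately have "(\<lambda>n. complex_of_real (\<theta> n x) * clip (g n x)) \<longlonglongrightarrow> 1 * clip (h x)"
          by (intro tendsto_mult)
        then show ?thesis
          using clip_id[OF B(2)[of x]] by (simp add: c_def)
      qed
    qed
  qed simp
  then obtain n where n: "c n \<in> L2" "L2_norm (\<lambda>x. h x - c n x) < \<epsilon> / 2"
    using L2_tendsto_approx[of c h "\<epsilon> / 2"] assms(3) by auto
  have "L2_norm (\<lambda>x. f x - c n x) < \<epsilon>"
    using L2_norm_triangle_diff[OF assms(1) h(1) n(1)] h(2) n(2) by linarith
  then show thesis
    using that c_cont n(1) c_0 c_bound by blast
qed

text \<open>Translations preserve the norm, so a uniform approximation error survives them and it
  suffices to treat a continuous function of bounded support, where pointwise convergence is
  dominated.\<close>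

lemma L2_translation_tendsto:
  assumes f: "f \<in> L2" and s: "s \<longlonglongrightarrow> 0"
  shows "(\<lambda>k. L2_norm (\<lambda>x. f (x + s k) - f x)) \<longlonglongrightarrow> 0"
proof (rule order_tendstoI)
  fix a :: real
  assume "a < 0"
  then show "\<forall>\<^sub>F k in sequentially. a < L2_norm (\<lambda>x. f (x + s k) - f x)"
    by (intro always_eventually allI less_le_trans[OF _ L2_norm_nonneg])
next
  fix \<epsilon> :: real
  assume \<epsilon>: "0 < \<epsilon>"
  obtain k where k: "(\<lambda>x. if \<bar>x\<bar> < real k then f x else 0) \<in> L2"
    "L2_norm (\<lambda>x. f x - (if \<bar>x\<bar> < real k then f x else 0)) < \<epsilon> / 6"
    using L2_approx_support[OF f, of "\<epsilon> / 6"] \<epsilon> by auto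
  define h where "h = (\<lambda>x. if \<bar>x\<bar> < real k then f x else 0)"
  have hL2: "h \<in> L2" and h0: "\<And>x. x \<notin> {-real k<..<real k} \<Longrightarrow> h x = 0"
    using k by (auto simp: h_def)
  obtain c B where c: "continuous_on UNIV c" "c \<in> L2" "\<And>x. x \<notin> {-real k<..<real k} \<Longrightarrow> c x = 0"
    "\<And>x. cmod (c x) \<le> B" "L2_norm (\<lambda>x. h x - c x) < \<epsilon> / 6"
    by (rule L2_approx_continuous[OF hL2 h0, where \<epsilon> = "\<epsilon> / 6"]) (use \<epsilon> in auto)
  have fc: "L2_norm (\<lambda>x. f x - c x) < \<epsilon> / 3"
    using L2_norm_triangle_diff[OF f hL2 c(2)] k(2) c(5) by (simp add: h_def)
  \<comment> \<open>A bound on all shifts confines every translate of c to one bounded interval,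
    which gives a common dominating function.\<close>
  obtain S where S: "\<And>n. \<bar>s n\<bar> \<le> S"
    using convergent_imp_Bseq[OF convergentI[OF s]] by (auto simp: Bseq_def)
  have B: "B \<ge> 0"
    using c(4)[of 0] norm_ge_zero order_trans by blast
  have cshift: "cmod (c (x + s n)) \<le> cmod (complex_of_real (B * indicator {-(real k + S)..real k + S} x))" for n x
  proof (cases "x + s n \<in> {-real k<..<real k}")
    case True
    then have "x \<in> {-(real k + S)..real k + S}"
      using S[of n] by auto
    then show ?thesis
      using c(4)[of "x + s n"] B by (simp add: norm_mult)
  qed (use c(3) in auto)
  have S0: "S \<ge> 0"
    using S[of 0] by simp
  have cno: "cmod (c x) \<le> cmod (complex_of_real (B * indicator {-(real k + S)..real k + S} x))" for x
  proof (cases "x \<in> {-real k<..<real k}")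
    case True
    then have "x \<in> {-(real k + S)..real k + S}"
      using S0 by auto
    then show ?thesis
      using c(4)[of "x"] B by (simp add: norm_mult)
  qed (use c(3) in auto)
  have [measurable]: "c \<in> borel_measurable borel"
    using c(1) by (rule borel_measurable_continuous_onI)
  have "L2_tendsto (\<lambda>n x. c (x + s n)) c"
  proof (rule L2_tendstoI_dominated[OF _ _ _ _ cshift cno])
    show "(\<lambda>x. complex_of_real (B * indicator {-(real k + S)..real k + S} x)) \<in> L2"
      by (rule L2_bounded_support[of _ B "-(real k + S)" "real k + S"]) (use B in \<open>auto simp: indicator_def\<close>)
    show "AE x in lborel. (\<lambda>n. c (x + s n)) \<longlonglongrightarrow> c x"
    proof (rule AE_I2)
      fix x
      have "(\<lambda>n. x + s n) \<longlonglongrightarrow> x + 0"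
        by (intro tendsto_intros s)
      moreover have "isCont c x"
        using c(1) by (simp add: continuous_on_eq_continuous_at)
      ultimately show "(\<lambda>n. c (x + s n)) \<longlonglongrightarrow> c x"
        using isCont_tendsto_compose by fastforce
    qed
  qed auto
  then have "(\<lambda>n. L2_norm (\<lambda>x. c (x + s n) - c x)) \<longlonglongrightarrow> 0"
    by (simp add: L2_tendsto_def)
  then have "\<forall>\<^sub>F n in sequentially. L2_norm (\<lambda>x. c (x + s n) - c x) < \<epsilon> / 3"
    using \<epsilon> by (intro order_tendstoD(2)) auto
  then show "\<forall>\<^sub>F n in sequentially. L2_norm (\<lambda>x. f (x + s n) - f x) < \<epsilon>"
  proof eventually_elim
    case (elim n)
    have shift: "(\<lambda>x. g (x + s n)) \<in> L2" if "g \<in> L2" for g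
      using L2_affine[OF that, of 1 "s n"] by (simp add: add.commute)
    have "L2_norm (\<lambda>x. f (x + s n) - c (x + s n)) = L2_norm (\<lambda>x. f x - c x)"
      using L2_norm_affine[of 1 "\<lambda>x. f x - c x" "s n"] by (simp add: add.commute)
    moreover have "L2_norm (\<lambda>x. f (x + s n) - f x)
        \<le> L2_norm (\<lambda>x. f (x + s n) - c (x + s n)) + L2_norm (\<lambda>x. c (x + s n) - f x)"
      by (intro L2_norm_triangle_diff shift f c)
    moreover have "L2_norm (\<lambda>x. c (x + s n) - f x)
        \<le> L2_norm (\<lambda>x. c (x + s n) - c x) + L2_norm (\<lambda>x. c x - f x)"
      by (intro L2_norm_triangle_diff shift f c)
    ultimately show ?case
      using elim fc L2_norm_minus_commute[of f c] by linarith
  qed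
qed

section \<open>The Plancherel identity\<close>

lemma fourier_L1_measurable [measurable]:
  assumes [measurable]: "f \<in> borel_measurable borel"
  shows "fourier_L1 f \<in> borel_measurable borel"
  unfolding fourier_L1_def by measurable

lemma integrable_fourier_integrand:
  assumes "integrable lborel f"
  shows "integrable lborel (\<lambda>x. f x * exp (- (\<i> * complex_of_real (\<omega> * x))))"
proof -
  have [measurable]: "f \<in> borel_measurable borel"
    using borel_measurable_integrable[OF assms] by simp
  have "(\<lambda>x. f x * exp (- (\<i> * complex_of_real (\<omega> * x)))) \<in> borel_measurable lborel"
    by measurable
  then show ?thesis
    by (rule Bochner_Integration.integrable_bound[OF assms]) (auto simp: norm_mult)
qed

lemma fourier_L1_bound:
  "cmod (fourier_L1 f \<omega>) \<le> (LINT x|lborel. cmod (f x))"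
proof -
  have "cmod (fourier_L1 f \<omega>) \<le> (LINT x|lborel. cmod (f x * exp (- (\<i> * complex_of_real (\<omega> * x)))))"
    unfolding fourier_L1_def by (rule integral_norm_bound)
  then show ?thesis
    by (simp add: norm_mult)
qed

text \<open>The kernel is symmetric in both variables and has modulus 1, so Fubini's theorem applies
  to the product of two integrable functions.\<close>

lemma fourier_L1_multiplication:
  assumes "integrable lborel f" "integrable lborel g"
  shows "(LINT \<omega>|lborel. fourier_L1 f \<omega> * g \<omega>) = (LINT x|lborel. f x * fourier_L1 g x)"
proof -
  have [measurable]: "f \<in> borel_measurable borel" "g \<in> borel_measurable borel"
    using assms[THEN borel_measurable_integrable] by auto
  have "integrable (lborel \<Otimes>\<^sub>M lborel)
      (\<lambda>(x, \<omega>). f x * exp (- (\<i> * complex_of_real (\<omega> * x))) * g \<omega>)"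
  proof (rule lborel_pair.Fubini_integrable)
    show "(\<lambda>(x, \<omega>). f x * exp (- (\<i> * complex_of_real (\<omega> * x))) * g \<omega>) \<in> borel_measurable (lborel \<Otimes>\<^sub>M lborel)"
      by measurable
    show "integrable lborel (\<lambda>x. LINT \<omega>|lborel.
        cmod (case (x, \<omega>) of (x, \<omega>) \<Rightarrow> f x * exp (- (\<i> * complex_of_real (\<omega> * x))) * g \<omega>))"
      using assms by (simp add: norm_mult)
    show "AE x in lborel. integrable lborel
        (\<lambda>\<omega>. case (x, \<omega>) of (x, \<omega>) \<Rightarrow> f x * exp (- (\<i> * complex_of_real (\<omega> * x))) * g \<omega>)"
    proof (rule AE_I2)
      fix x
      show "integrable lborel (\<lambda>\<omega>. case (x, \<omega>) of (x, \<omega>) \<Rightarrow> f x * exp (- (\<i> * complex_of_real (\<omega> * x))) * g \<omega>)"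
        using integrable_mult_right[OF integrable_fourier_integrand[OF assms(2), of x], of "f x"]
        by (simp add: mult_ac)
    qed
  qed
  from lborel_pair.Fubini_integral[OF this]
  have "(LINT \<omega>|lborel. LINT x|lborel. f x * exp (- (\<i> * complex_of_real (\<omega> * x))) * g \<omega>)
      = (LINT x|lborel. LINT \<omega>|lborel. f x * exp (- (\<i> * complex_of_real (\<omega> * x))) * g \<omega>)" .
  also have "(LINT \<omega>|lborel. LINT x|lborel. f x * exp (- (\<i> * complex_of_real (\<omega> * x))) * g \<omega>)
      = (LINT \<omega>|lborel. fourier_L1 f \<omega> * g \<omega>)"
    by (simp add: fourier_L1_def)
  also have "(LINT x|lborel. LINT \<omega>|lborel. f x * exp (- (\<i> * complex_of_real (\<omega> * x))) * g \<omega>)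
      = (LINT x|lborel. f x * fourier_L1 g x)"
    by (simp add: fourier_L1_def mult_ac flip: integral_mult_right_zero)
  finally show ?thesis .
qed

text \<open>A rescaling of the characteristic function of the standard normal law. The right side is
  \<open>2 * pi\<close> times the density at u of the centred normal law with standard deviation 1 /
  K, hence an approximate identity of mass \<open>2 * pi\<close>; this is where the Plancherel
  constant originates.\<close>

lemma integral_gaussian_iexp:
  assumes "K > 0"
  shows "(LINT \<omega>|lborel. complex_of_real (exp (- (\<omega> / K)\<^sup>2 / 2)) * exp (\<i> * complex_of_real (\<omega> * u)))
    = complex_of_real (2 * pi * K * std_normal_density (K * u))"
proof -
  have "complex_of_real (exp (- ((K * u)\<^sup>2) / 2)) = (CLINT x|std_normal_distribution. iexp (K * u * x))"
    using fun_cong[OF char_std_normal_distribution, of "K * u"] by (simp add: char_def)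
  also have "\<dots> = (LINT x|lborel. std_normal_density x *\<^sub>R iexp (K * u * x))"
    by (intro integral_density) auto
  also have "\<dots> = (LINT x|lborel. (1 / sqrt (2 * pi)) *\<^sub>R (complex_of_real (exp (- x\<^sup>2 / 2)) * exp (\<i> * complex_of_real (x * (K * u)))))"
    by (simp add: std_normal_density_def scaleR_conv_of_real mult_ac)
  also have "\<dots> = (1 / sqrt (2 * pi)) *\<^sub>R (LINT x|lborel. (complex_of_real (exp (- x\<^sup>2 / 2)) * exp (\<i> * complex_of_real (x * (K * u)))))"
    by (rule integral_scaleR_right)
  also have "(LINT x|lborel. (complex_of_real (exp (- x\<^sup>2 / 2)) * exp (\<i> * complex_of_real (x * (K * u)))))
     = \<bar>1 / K\<bar> *\<^sub>R (LINT x|lborel. (complex_of_real (exp (- (0 + 1 / K * x)\<^sup>2 / 2)) * exp (\<i> * complex_of_real ((0 + 1 / K * x) * (K * u)))))"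
    by (rule lborel_integral_real_affine) (use assms in auto)
  also have "\<dots> = (1 / K) *\<^sub>R (LINT \<omega>|lborel. complex_of_real (exp (- (\<omega> / K)\<^sup>2 / 2)) * exp (\<i> * complex_of_real (\<omega> * u)))"
    using assms by (simp add: field_simps)
  finally have eq: "complex_of_real (exp (- ((K * u)\<^sup>2) / 2)) = (1 / sqrt (2 * pi)) *\<^sub>R (1 / K) *\<^sub>R
      (LINT \<omega>|lborel. complex_of_real (exp (- (\<omega> / K)\<^sup>2 / 2)) * exp (\<i> * complex_of_real (\<omega> * u)))" .
  have "(LINT \<omega>|lborel. complex_of_real (exp (- (\<omega> / K)\<^sup>2 / 2)) * exp (\<i> * complex_of_real (\<omega> * u)))
     = (K * sqrt (2 * pi)) *\<^sub>R complex_of_real (exp (- ((K * u)\<^sup>2) / 2))"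
    unfolding eq using assms by simp
  also have "\<dots> = complex_of_real (2 * pi * K * std_normal_density (K * u))"
  proof -
    have "K * sqrt (2 * pi) = 2 * pi * K * (1 / sqrt (2 * pi))"
      using real_sqrt_mult_self[of "2 * pi"] by (simp add: field_simps)
    then show ?thesis
      unfolding std_normal_density_def scaleR_conv_of_real of_real_mult[symmetric] by (simp add: mult_ac)
  qed
  finally show ?thesis .
qed

lemma integrable_gaussian:
  assumes "K > 0"
  shows "integrable lborel (\<lambda>\<omega>::real. exp (- (\<omega> / K)\<^sup>2 / 2))"
proof -
  have "integrable lborel (\<lambda>\<omega>::real. sqrt (2 * pi) * std_normal_density (0 + (1 / K) * \<omega>))"
    using assms by (intro integrable_mult_right lborel_integrable_real_affine) auto
  then show ?thesis
    by (simp add: std_normal_density_def)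
qed

definition L2_autocorr :: "(real \<Rightarrow> complex) \<Rightarrow> real \<Rightarrow> complex" where
  "L2_autocorr f s = (LINT x|lborel. f x * cnj (f (x + s)))"

text \<open>
  The Gaussian weight makes the integral absolutely convergent, so that the multiplication formula
  applies; it turns the weighted energy into an average of autocorrelations at shifts that tend to 0.
\<close>
lemma gaussian_weighted_fourier:
  assumes f1: "integrable lborel f" and f2: "f \<in> L2" and K: "K > 0"
  shows "(LINT \<omega>|lborel. complex_of_real ((cmod (fourier_L1 f \<omega>))\<^sup>2 * exp (- (\<omega> / K)\<^sup>2 / 2)))
    = 2 * pi * (LINT t|lborel. std_normal_density t * L2_autocorr f (t / K))"
proof -
  have [measurable]: "f \<in> borel_measurable borel"
    using f2 by (rule L2_measurable)
  define W where "W = (\<lambda>\<omega>. complex_of_real (exp (- (\<omega> / K)\<^sup>2 / 2)))"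
  have [measurable]: "W \<in> borel_measurable borel"
    unfolding W_def by measurable
  have W: "integrable lborel W"
    unfolding W_def using integrable_gaussian[OF K] by simp
  have W_cnj: "cnj (W \<omega>) = W \<omega>" for \<omega>
    by (simp add: W_def)
  \<comment> \<open>Chosen so that its product with the transform of f is the weighted energy; the
    transform is bounded, so the Gaussian makes G integrable.\<close>
  define G where "G = (\<lambda>\<omega>. cnj (fourier_L1 f \<omega>) * W \<omega>)"
  have G: "integrable lborel G"
  proof (rule Bochner_Integration.integrable_bound)
    show "integrable lborel (\<lambda>\<omega>. complex_of_real (LINT x|lborel. cmod (f x)) * W \<omega>)"
      using W by simp
    show "G \<in> borel_measurable lborel"
      unfolding G_def by measurable
    show "AE \<omega> in lborel. norm (G \<omega>) \<le> norm (complex_of_real (LINT x|lborel. cmod (f x)) * W \<omega>)"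
      using fourier_L1_bound[of f] by (auto simp: G_def norm_mult intro!: mult_right_mono)
  qed
  have G_hat: "fourier_L1 G x = 2 * pi * (LINT t|lborel. std_normal_density t * cnj (f (x + t / K)))" for x
  proof -
    \<comment> \<open>Modulating by x centres the transform of the Gaussian at x, so integrating f
      against it averages f near x.\<close>
    define Wx where "Wx = (\<lambda>\<omega>. W \<omega> * exp (\<i> * complex_of_real (\<omega> * x)))"
    have Wx: "integrable lborel Wx"
      using integrable_fourier_integrand[OF W, of "-x"] by (simp add: Wx_def mult_ac)
    have Wx_hat: "fourier_L1 Wx y = complex_of_real (2 * pi * K * std_normal_density (K * (y - x)))" for y
    proof -
      have "fourier_L1 Wx y = (LINT \<omega>|lborel. W \<omega> * exp (\<i> * complex_of_real (\<omega> * (x - y))))"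
        unfolding fourier_L1_def Wx_def
        by (intro Bochner_Integration.integral_cong refl) (simp add: algebra_simps flip: exp_add)
      also have "\<dots> = complex_of_real (2 * pi * K * std_normal_density (K * (x - y)))"
        unfolding W_def by (rule integral_gaussian_iexp[OF K])
      also have "std_normal_density (K * (x - y)) = std_normal_density (K * (y - x))"
        by (simp add: std_normal_density_def power2_eq_square algebra_simps)
      finally show ?thesis .
    qed
    \<comment> \<open>W is real, so conjugation reverses only the exponential and exposes an
      integral to which the multiplication formula applies again.\<close>
    have "fourier_L1 G x = (LINT \<omega>|lborel. cnj (fourier_L1 f \<omega> * Wx \<omega>))"
      unfolding fourier_L1_def[of G x]
      by (intro Bochner_Integration.integral_cong refl) (simp add: G_def Wx_def W_cnj exp_cnj mult_ac)
    also have "\<dots> = cnj (LINT \<omega>|lborel. fourier_L1 f \<omega> * Wx \<omega>)"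
      by (rule Bochner_Integration.integral_cnj)
    also have "(LINT \<omega>|lborel. fourier_L1 f \<omega> * Wx \<omega>) = (LINT y|lborel. f y * fourier_L1 Wx y)"
      by (rule fourier_L1_multiplication[OF f1 Wx])
    also have "\<dots> = \<bar>1 / K\<bar> *\<^sub>R (LINT t|lborel. f (x + 1 / K * t) * fourier_L1 Wx (x + 1 / K * t))"
      using K by (intro lborel_integral_real_affine) auto
    also have "\<dots> = 2 * pi * (LINT t|lborel. std_normal_density t * f (x + t / K))"
      unfolding Wx_hat using K 
      by (simp add: scaleR_conv_of_real mult_ac flip: integral_mult_right_zero)
    finally show ?thesis
      by (simp flip: Bochner_Integration.integral_cnj)
  qed
  have "(LINT \<omega>|lborel. complex_of_real ((cmod (fourier_L1 f \<omega>))\<^sup>2 * exp (- (\<omega> / K)\<^sup>2 / 2)))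
      = (LINT \<omega>|lborel. fourier_L1 f \<omega> * G \<omega>)"
    by (intro Bochner_Integration.integral_cong refl)
       (simp add: G_def W_def complex_norm_square[symmetric] mult.assoc[symmetric] del: of_real_power)
  also have "\<dots> = (LINT x|lborel. f x * fourier_L1 G x)"
    by (rule fourier_L1_multiplication[OF f1 G])
  also have "\<dots> = 2 * pi * (LINT x|lborel. LINT t|lborel. f x * (std_normal_density t * cnj (f (x + t / K))))"
    unfolding G_hat by (simp add: mult_ac flip: integral_mult_right_zero)
  also have "(LINT x|lborel. LINT t|lborel. f x * (std_normal_density t * cnj (f (x + t / K))))
     = (LINT t|lborel. LINT x|lborel. f x * (std_normal_density t * cnj (f (x + t / K))))"
  \<comment> \<open>By Cauchy-Schwarz the inner integral of the moduli is at most the squared norm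
    of f times the normal density, uniformly in the shift; this gives absolute
    integrability.\<close>
  proof (rule lborel_pair.Fubini_integral, rule lborel_pair.Fubini_integrable)
    have shift: "(\<lambda>x. f (x + s)) \<in> L2" "L2_norm (\<lambda>x. f (x + s)) = L2_norm f" for s
      using L2_affine[OF f2, of 1 s] L2_norm_affine[of 1 f s] by (simp_all add: add.commute)
    show "(\<lambda>(t, x). f x * (std_normal_density t * cnj (f (x + t / K)))) \<in> borel_measurable (lborel \<Otimes>\<^sub>M lborel)"
      by measurable
    show "AE t in lborel. integrable lborel (\<lambda>x. case (t, x) of (t, x) \<Rightarrow> f x * (std_normal_density t * cnj (f (x + t / K))))"
    proof (rule AE_I2)
      fix t
      show "integrable lborel (\<lambda>x. case (t, x) of (t, x) \<Rightarrow> f x * (std_normal_density t * cnj (f (x + t / K))))"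
        using integrable_mult_right[OF L2_integrable_mult[OF f2 shift(1)[of "t / K"]], of "complex_of_real (std_normal_density t)"]
        by (simp add: mult_ac)
    qed
    show "integrable lborel (\<lambda>t. LINT x|lborel. norm (case (t, x) of (t, x) \<Rightarrow> f x * (std_normal_density t * cnj (f (x + t / K)))))"
    proof (rule Bochner_Integration.integrable_bound)
      show "integrable lborel (\<lambda>t. (L2_norm f)\<^sup>2 * std_normal_density t)"
        by simp
      show "AE t in lborel. norm (LINT x|lborel. norm (case (t, x) of (t, x) \<Rightarrow> f x * (std_normal_density t * cnj (f (x + t / K)))))
         \<le> norm ((L2_norm f)\<^sup>2 * std_normal_density t)"
      proof (rule AE_I2)
        fix t
        have "(LINT x|lborel. norm (case (t, x) of (t, x) \<Rightarrow> f x * (std_normal_density t * cnj (f (x + t / K)))))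
          = std_normal_density t * (LINT x|lborel. cmod (f x) * cmod (f (x + t / K)))"
          by (simp add: norm_mult mult_ac flip: integral_mult_right_zero)
        also have "\<dots> \<le> std_normal_density t * (L2_norm f * L2_norm f)"
          using L2_Cauchy_Schwarz[OF f2 shift(1)[of "t / K"]] shift(2)[of "t / K"]
          by (intro mult_left_mono) auto
        finally show "norm (LINT x|lborel. norm (case (t, x) of (t, x) \<Rightarrow> f x * (std_normal_density t * cnj (f (x + t / K)))))
         \<le> norm ((L2_norm f)\<^sup>2 * std_normal_density t)"
          by (simp add: power2_eq_square mult_ac)
      qed
    qed measurable
  qed
  also have "\<dots> = (LINT t|lborel. std_normal_density t * L2_autocorr f (t / K))"
    unfolding L2_autocorr_def by (simp add: mult_ac flip: integral_mult_right_zero)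
  finally show ?thesis .
qed

text \<open>The difference from the limit is the inner product of f with its increment under
  translation, so Cauchy-Schwarz reduces the claim to continuity of translations.\<close>

lemma L2_autocorr_tendsto:
  assumes f: "f \<in> L2" and s: "s \<longlonglongrightarrow> 0"
  shows "(\<lambda>n. L2_autocorr f (s n)) \<longlonglongrightarrow> complex_of_real ((L2_norm f)\<^sup>2)"
proof -
  have shift: "(\<lambda>x. f (x + s)) \<in> L2" for s
    using L2_affine[OF f, of 1 s] by (simp_all add: add.commute)
  have "(\<lambda>n. L2_autocorr f (s n) - complex_of_real ((L2_norm f)\<^sup>2)) \<longlonglongrightarrow> 0"
  proof (rule Lim_null_comparison)
    have eq: "L2_autocorr f (s n) - complex_of_real ((L2_norm f)\<^sup>2) = L2_inner f (\<lambda>x. f (x + s n) - f x)" for n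
    proof -
      have "complex_of_real ((L2_norm f)\<^sup>2) = (LINT x|lborel. f x * cnj (f x))"
        unfolding L2_norm_power2 integral_complex_of_real[symmetric] complex_norm_square ..
      then show ?thesis
        unfolding L2_autocorr_def L2_inner_def
        using Bochner_Integration.integral_diff[OF L2_integrable_mult[OF f shift] L2_integrable_mult[OF f f], of "s n"]
        by (simp add: algebra_simps)
    qed
    show "\<forall>\<^sub>F n in sequentially. cmod (L2_autocorr f (s n) - complex_of_real ((L2_norm f)\<^sup>2))
       \<le> L2_norm f * L2_norm (\<lambda>x. f (x + s n) - f x)"
      unfolding eq by (intro always_eventually allI L2_inner_bound f L2_diff shift)
    show "(\<lambda>n. L2_norm f * L2_norm (\<lambda>x. f (x + s n) - f x)) \<longlonglongrightarrow> 0"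
      by (intro tendsto_mult_right_zero L2_translation_tendsto f s)
  qed
  then show ?thesis
    using Lim_null by blast
qed

text \<open>The weighted energies are evaluated in two ways: as averages of autocorrelations they
  tend to \<open>2 * pi\<close> times the squared norm of f, and by monotone convergence they tend
  to the full energy of the transform.\<close>

theorem Plancherel_L1_L2:
  assumes f1: "integrable lborel f" and f2: "f \<in> L2"
  shows "fourier_L1 f \<in> L2" "L2_norm (fourier_L1 f) = sqrt (2 * pi) * L2_norm f"
proof -
  have [measurable]: "f \<in> borel_measurable borel"
    using f2 by (rule L2_measurable)
  define F where "F = (\<lambda>n \<omega>. (cmod (fourier_L1 f \<omega>))\<^sup>2 * exp (- (\<omega> / real (Suc n))\<^sup>2 / 2))"
  have F_int: "integrable lborel (F n)" for n
  proof (rule Bochner_Integration.integrable_bound)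
    show "integrable lborel (\<lambda>\<omega>. (LINT x|lborel. cmod (f x))\<^sup>2 * exp (- (\<omega> / real (Suc n))\<^sup>2 / 2))"
      by (intro integrable_mult_right integrable_gaussian) simp
    show "AE \<omega> in lborel. norm (F n \<omega>) \<le> norm ((LINT x|lborel. cmod (f x))\<^sup>2 * exp (- (\<omega> / real (Suc n))\<^sup>2 / 2))"
      using fourier_L1_bound[of f] by (auto simp: F_def abs_mult intro!: mult_right_mono power_mono)
    show "F n \<in> borel_measurable lborel"
      unfolding F_def by measurable
  qed
  have lim: "(\<lambda>n. LINT \<omega>|lborel. F n \<omega>) \<longlonglongrightarrow> 2 * pi * (L2_norm f)\<^sup>2"
  proof -
    have meas: "(\<lambda>t. L2_autocorr f (t / real (Suc n))) \<in> borel_measurable borel" for n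
      unfolding L2_autocorr_def by measurable
    \<comment> \<open>For each fixed t the shift tends to 0, and the autocorrelation never exceeds
      the squared norm of f, so the normal density dominates.\<close>
    have "(\<lambda>n. LINT t|lborel. complex_of_real (std_normal_density t) * L2_autocorr f (t / real (Suc n)))
        \<longlonglongrightarrow> (LINT t|lborel. complex_of_real (std_normal_density t) * complex_of_real ((L2_norm f)\<^sup>2))"
    proof (rule integral_dominated_convergence[where w = "\<lambda>t. std_normal_density t * (L2_norm f)\<^sup>2"])
      show "AE t in lborel. (\<lambda>n. complex_of_real (std_normal_density t) * L2_autocorr f (t / real (Suc n)))
         \<longlonglongrightarrow> complex_of_real (std_normal_density t) * complex_of_real ((L2_norm f)\<^sup>2)"
      proof (intro AE_I2 tendsto_mult_left L2_autocorr_tendsto f2)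
        fix t :: real
        show "(\<lambda>n. t / real (Suc n)) \<longlonglongrightarrow> 0"
          using LIMSEQ_Suc[OF lim_const_over_n[of t]] by simp
      qed
      show "AE t in lborel. norm (complex_of_real (std_normal_density t) * L2_autocorr f (t / real (Suc n)))
         \<le> std_normal_density t * (L2_norm f)\<^sup>2" for n
      proof (rule AE_I2)
        fix t :: real
        define s where "s = t / real (Suc n)"
        have shift: "(\<lambda>x. f (x + s)) \<in> L2" "L2_norm (\<lambda>x. f (x + s)) = L2_norm f"
          using L2_affine[OF f2, of 1 s] L2_norm_affine[of 1 f s] by (simp_all add: add.commute)
        have "cmod (L2_autocorr f s) \<le> (L2_norm f)\<^sup>2"
          using L2_inner_bound[OF f2 shift(1)] by (simp add: L2_autocorr_def L2_inner_def shift(2) power2_eq_square)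
        then show "norm (complex_of_real (std_normal_density t) * L2_autocorr f (t / real (Suc n)))
           \<le> std_normal_density t * (L2_norm f)\<^sup>2"
          unfolding s_def[symmetric] by (simp add: norm_mult mult_left_mono)
      qed
    qed (use meas in \<open>auto intro!: borel_measurable_times\<close>)
    also have "(LINT t|lborel. complex_of_real (std_normal_density t) * complex_of_real ((L2_norm f)\<^sup>2))
        = complex_of_real ((L2_norm f)\<^sup>2)"
      by (simp flip: of_real_mult of_real_power)
    finally have "(\<lambda>n. 2 * pi * (LINT t|lborel. complex_of_real (std_normal_density t) * L2_autocorr f (t / real (Suc n))))
        \<longlonglongrightarrow> 2 * pi * complex_of_real ((L2_norm f)\<^sup>2)"
      by (intro tendsto_mult_left)
    then have "(\<lambda>n. LINT \<omega>|lborel. complex_of_real (F n \<omega>)) \<longlonglongrightarrow> complex_of_real (2 * pi * (L2_norm f)\<^sup>2)"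
      unfolding F_def by (subst gaussian_weighted_fourier[OF f1 f2]) simp_all
    then have "(\<lambda>n. complex_of_real (LINT \<omega>|lborel. F n \<omega>)) \<longlonglongrightarrow> complex_of_real (2 * pi * (L2_norm f)\<^sup>2)"
      by simp
    then show ?thesis
      by (simp only: tendsto_of_real_iff)
  qed
  \<comment> \<open>Monotone convergence is used because no integrable majorant of the energy is
    available yet; it yields integrability together with the value.\<close>
  have mono: "AE \<omega> in lborel. mono (\<lambda>n. F n \<omega>)"
  proof (intro AE_I2 monoI)
    fix \<omega> :: real and m n :: nat
    assume "m \<le> n"
    then have "\<bar>\<omega>\<bar> / real (Suc n) \<le> \<bar>\<omega>\<bar> / real (Suc m)"
      by (intro divide_left_mono) auto
    then have "(\<bar>\<omega>\<bar> / real (Suc n))\<^sup>2 \<le> (\<bar>\<omega>\<bar> / real (Suc m))\<^sup>2"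
      by (intro power_mono) auto
    then show "F m \<omega> \<le> F n \<omega>"
      unfolding F_def by (intro mult_left_mono) (auto simp: power_divide)
  qed
  have ptlim: "AE \<omega> in lborel. (\<lambda>n. F n \<omega>) \<longlonglongrightarrow> (cmod (fourier_L1 f \<omega>))\<^sup>2"
  proof (rule AE_I2)
    fix \<omega> :: real
    have "(\<lambda>n. \<omega> / real (Suc n)) \<longlonglongrightarrow> 0"
      using LIMSEQ_Suc[OF lim_const_over_n[of \<omega>]] by simp
    then have "(\<lambda>n. F n \<omega>) \<longlonglongrightarrow> (cmod (fourier_L1 f \<omega>))\<^sup>2 * exp (- (0::real)\<^sup>2 / 2)"
      unfolding F_def by (intro tendsto_intros) auto
    then show "(\<lambda>n. F n \<omega>) \<longlonglongrightarrow> (cmod (fourier_L1 f \<omega>))\<^sup>2"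
      by simp
  qed
  have "(\<lambda>\<omega>. (cmod (fourier_L1 f \<omega>))\<^sup>2) \<in> borel_measurable lborel"
    by measurable
  note conv = F_int mono ptlim lim this
  show "fourier_L1 f \<in> L2"
    using integrable_monotone_convergence[OF conv] by (intro L2_I) auto
  show "L2_norm (fourier_L1 f) = sqrt (2 * pi) * L2_norm f"
    unfolding L2_norm_def[of "fourier_L1 f"] integral_monotone_convergence[OF conv]
    by (simp add: real_sqrt_mult L2_norm_nonneg)
qed

section \<open>Fourier transforms of square-integrable functions and orthonormal bases\<close>

lemma has_fourier_L2_L2:
  assumes "has_fourier_L2 f g"
  shows "f \<in> L2" "g \<in> L2"
  using assms by (auto simp: has_fourier_L2_def L2_tendsto_def)

text \<open>Each approximant is both integrable and square-integrable, so the identity holds along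
  the sequence, and norms are continuous on both sides.\<close>

lemma has_fourier_L2_norm:
  assumes "has_fourier_L2 f g"
  shows "L2_norm g = sqrt (2 * pi) * L2_norm f"
proof -
  obtain F where F: "\<And>k. integrable lborel (F k)" "L2_tendsto F f" "L2_tendsto (\<lambda>k. fourier_L1 (F k)) g"
    using assms by (auto simp: has_fourier_L2_def)
  have "F k \<in> L2" for k
    using F(2) by (simp add: L2_tendsto_def)
  then have "(\<lambda>k. sqrt (2 * pi) * L2_norm (F k)) \<longlonglongrightarrow> L2_norm g"
    using L2_tendsto_norm[OF F(3)] Plancherel_L1_L2(2)[OF F(1)] by simp
  moreover have "(\<lambda>k. sqrt (2 * pi) * L2_norm (F k)) \<longlonglongrightarrow> sqrt (2 * pi) * L2_norm f"
    by (intro tendsto_mult_left L2_tendsto_norm F)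
  ultimately show ?thesis
    by (rule LIMSEQ_unique)
qed

lemma has_fourier_L2_L1:
  assumes "integrable lborel f" "f \<in> L2"
  shows "has_fourier_L2 f (fourier_L1 f)"
proof -
  have "L2_tendsto (\<lambda>k. h) h" if "h \<in> L2" for h
    using that by (simp add: L2_tendsto_def L2_norm_def)
  then show ?thesis
    unfolding has_fourier_L2_def using assms Plancherel_L1_L2(1)[OF assms]
    by (intro exI[of _ "\<lambda>k. f"]) auto
qed

lemma has_fourier_L2_add:
  assumes "has_fourier_L2 f1 g1" "has_fourier_L2 f2 g2"
  shows "has_fourier_L2 (\<lambda>x. f1 x + f2 x) (\<lambda>\<omega>. g1 \<omega> + g2 \<omega>)"
proof -
  obtain F where F: "\<And>k. integrable lborel (F k)" "L2_tendsto F f1" "L2_tendsto (\<lambda>k. fourier_L1 (F k)) g1"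
    using assms(1) by (auto simp: has_fourier_L2_def)
  obtain G where G: "\<And>k. integrable lborel (G k)" "L2_tendsto G f2" "L2_tendsto (\<lambda>k. fourier_L1 (G k)) g2"
    using assms(2) by (auto simp: has_fourier_L2_def)
  have "fourier_L1 (\<lambda>x. F k x + G k x) = (\<lambda>\<omega>. fourier_L1 (F k) \<omega> + fourier_L1 (G k) \<omega>)" for k
    using integrable_fourier_integrand[OF F(1)] integrable_fourier_integrand[OF G(1)]
    by (simp add: fourier_L1_def fun_eq_iff distrib_right)
  then show ?thesis
    unfolding has_fourier_L2_def
    using F G L2_tendsto_add[OF F(2) G(2)] L2_tendsto_add[OF F(3) G(3)]
    by (intro exI[of _ "\<lambda>k x. F k x + G k x"]) auto
qed

lemma has_fourier_L2_cmult:
  assumes "has_fourier_L2 f g"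
  shows "has_fourier_L2 (\<lambda>x. c * f x) (\<lambda>\<omega>. c * g \<omega>)"
proof -
  obtain F where F: "\<And>k. integrable lborel (F k)" "L2_tendsto F f" "L2_tendsto (\<lambda>k. fourier_L1 (F k)) g"
    using assms(1) by (auto simp: has_fourier_L2_def)
  have "fourier_L1 (\<lambda>x. c * F k x) = (\<lambda>\<omega>. c * fourier_L1 (F k) \<omega>)" for k
    by (simp add: fourier_L1_def fun_eq_iff mult.assoc)
  then show ?thesis
    unfolding has_fourier_L2_def
    using F L2_tendsto_cmult[OF F(2)] L2_tendsto_cmult[OF F(3)]
    by (intro exI[of _ "\<lambda>k x. c * F k x"]) auto
qed

lemma has_fourier_L2_diff:
  assumes "has_fourier_L2 f1 g1" "has_fourier_L2 f2 g2"
  shows "has_fourier_L2 (\<lambda>x. f1 x - f2 x) (\<lambda>\<omega>. g1 \<omega> - g2 \<omega>)"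
  using has_fourier_L2_add[OF assms(1) has_fourier_L2_cmult[OF assms(2), of "-1"]] by simp

lemma has_fourier_L2_zero: "has_fourier_L2 (\<lambda>x. 0) (\<lambda>\<omega>. 0)"
  using has_fourier_L2_L1[of "\<lambda>x. 0"] by (simp add: L2_zero fourier_L1_def[abs_def])

lemma has_fourier_L2_sum:
  assumes "\<And>i. i \<in> A \<Longrightarrow> has_fourier_L2 (f i) (g i)"
  shows "has_fourier_L2 (\<lambda>x. \<Sum>i\<in>A. f i x) (\<lambda>\<omega>. \<Sum>i\<in>A. g i \<omega>)"
  using assms by (induction A rule: infinite_finite_induct) (auto intro: has_fourier_L2_zero has_fourier_L2_add)

text \<open>The relation is linear, so the norm identity holds for f1, f2, f1 + f2 and f1 + \<i> f2,
  which are the norms in the polarization formula.\<close>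

theorem Parseval_L2:
  assumes "has_fourier_L2 f1 g1" "has_fourier_L2 f2 g2"
  shows "L2_inner g1 g2 = 2 * pi * L2_inner f1 f2"
proof -
  note fs = has_fourier_L2_L2(1)[OF assms(1)] has_fourier_L2_L2(1)[OF assms(2)]
  note gs = has_fourier_L2_L2(2)[OF assms(1)] has_fourier_L2_L2(2)[OF assms(2)]
  have norm2: "(L2_norm g)\<^sup>2 = 2 * pi * (L2_norm f)\<^sup>2" if "has_fourier_L2 f g" for f g
    using has_fourier_L2_norm[OF that] by (simp add: power_mult_distrib)
  note norms = norm2[OF assms(1)] norm2[OF assms(2)] norm2[OF has_fourier_L2_add[OF assms]]
    norm2[OF has_fourier_L2_add[OF assms(1) has_fourier_L2_cmult[OF assms(2), of \<i>]]]
  show ?thesis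
    unfolding L2_inner_polarization[OF fs] L2_inner_polarization[OF gs] norms
    by (simp add: algebra_simps diff_divide_distrib)
qed

lemma L2_tendsto_phase:
  assumes "L2_tendsto F f" "u \<in> borel_measurable borel" "\<And>x. cmod (u x) = 1"
  shows "L2_tendsto (\<lambda>k x. u x * F k x) (\<lambda>x. u x * f x)"
proof -
  have *: "(\<lambda>x. u x * h x) \<in> L2" if "h \<in> L2" for h
    by (rule L2_bound[OF _ that])
       (use assms(2,3) L2_measurable[OF that] in \<open>auto simp: norm_mult intro!: borel_measurable_times\<close>)
  have "L2_norm (\<lambda>x. u x * F k x - u x * f x) = L2_norm (\<lambda>x. F k x - f x)" for k
    using assms(3) by (simp add: L2_norm_def norm_mult flip: right_diff_distrib)
  then show ?thesis
    using assms(1) * by (simp add: L2_tendsto_def)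
qed

text \<open>For the integrable approximants this is a change of variables. It passes to the limit
  because affine substitution multiplies L2 norms by a fixed factor and a unimodular phase preserves
  them.\<close>

lemma has_fourier_L2_affine:
  assumes "has_fourier_L2 f g" "a > 0"
  shows "has_fourier_L2 (\<lambda>x. f (a * x - b))
    (\<lambda>\<omega>. complex_of_real (1 / a) * (cis (- (\<omega> * b / a)) * g (\<omega> / a)))"
proof -
  obtain F where F: "\<And>k. integrable lborel (F k)" "L2_tendsto F f" "L2_tendsto (\<lambda>k. fourier_L1 (F k)) g"
    using assms(1) by (auto simp: has_fourier_L2_def)
  have four: "fourier_L1 (\<lambda>x. F k (a * x - b))
      = (\<lambda>\<omega>. complex_of_real (1 / a) * (cis (- (\<omega> * b / a)) * fourier_L1 (F k) (\<omega> / a)))" for k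
  proof
    fix \<omega>
    have "fourier_L1 (F k) (\<omega> / a)
        = \<bar>a\<bar> *\<^sub>R (LINT x|lborel. F k (-b + a * x) * exp (- (\<i> * complex_of_real (\<omega> / a * (-b + a * x)))))"
      unfolding fourier_L1_def using assms(2) by (intro lborel_integral_real_affine) auto
    also have "(\<lambda>x. F k (-b + a * x) * exp (- (\<i> * complex_of_real (\<omega> / a * (-b + a * x)))))
      = (\<lambda>x. cis (\<omega> * b / a) * (F k (a * x - b) * exp (- (\<i> * complex_of_real (\<omega> * x)))))"
      using assms(2) by (auto simp: fun_eq_iff cis_conv_exp algebra_simps simp flip: exp_add)
    finally have "fourier_L1 (F k) (\<omega> / a) = a * (cis (\<omega> * b / a) * fourier_L1 (\<lambda>x. F k (a * x - b)) \<omega>)"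
      using assms(2) by (simp add: fourier_L1_def scaleR_conv_of_real)
    then have "complex_of_real (1 / a) * (cis (- (\<omega> * b / a)) * fourier_L1 (F k) (\<omega> / a))
      = (cis (- (\<omega> * b / a)) * cis (\<omega> * b / a)) * fourier_L1 (\<lambda>x. F k (a * x - b)) \<omega>"
      using assms(2) by (simp add: field_simps)
    then show "fourier_L1 (\<lambda>x. F k (a * x - b)) \<omega>
      = complex_of_real (1 / a) * (cis (- (\<omega> * b / a)) * fourier_L1 (F k) (\<omega> / a))"
      by (simp add: cis_mult)
  qed
  have "integrable lborel (\<lambda>x. F k (a * x - b))" for k
    using lborel_integrable_real_affine[OF F(1)[of k], of a "-b"] assms(2) by simp
  moreover have "L2_tendsto (\<lambda>k x. F k (a * x - b)) (\<lambda>x. f (a * x - b))"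
    using L2_tendsto_affine[OF F(2), of a "-b"] assms(2) by simp
  moreover have "L2_tendsto (\<lambda>k. fourier_L1 (\<lambda>x. F k (a * x - b)))
     (\<lambda>\<omega>. complex_of_real (1 / a) * (cis (- (\<omega> * b / a)) * g (\<omega> / a)))"
  proof -
    have "L2_tendsto (\<lambda>k \<omega>. fourier_L1 (F k) (\<omega> / a)) (\<lambda>\<omega>. g (\<omega> / a))"
      using L2_tendsto_affine[OF F(3), of "1 / a" 0] assms(2) by simp
    moreover have "(\<lambda>\<omega>. cis (- (\<omega> * b / a))) \<in> borel_measurable borel"
      using assms(2) by (intro borel_measurable_continuous_onI continuous_intros) auto
    ultimately show ?thesis
      unfolding four by (intro L2_tendsto_cmult L2_tendsto_phase) auto
  qed
  ultimately show ?thesis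
    unfolding has_fourier_L2_def by (intro exI[of _ "\<lambda>k x. F k (a * x - b)"]) auto
qed

section \<open>Approximation by finite linear combinations\<close>

definition L2_approximable :: "'i set \<Rightarrow> ('i \<Rightarrow> real \<Rightarrow> complex) \<Rightarrow> (real \<Rightarrow> complex) \<Rightarrow> bool" where
  "L2_approximable I E g \<longleftrightarrow>
     (\<forall>\<epsilon>>0. \<exists>A c. finite A \<and> A \<subseteq> I \<and> L2_norm (\<lambda>x. g x - (\<Sum>i\<in>A. c i * E i x)) < \<epsilon>)"

lemma L2_approximableE:
  assumes "L2_approximable I E g" "\<epsilon> > 0"
  obtains A c where "finite A" "A \<subseteq> I" "L2_norm (\<lambda>x. g x - (\<Sum>i\<in>A. c i * E i x)) < \<epsilon>"
  using assms unfolding L2_approximable_def by blast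

lemma L2_approximable_zero: "L2_approximable I E (\<lambda>x. 0)"
  unfolding L2_approximable_def by (auto intro!: exI[of _ "{}"] simp: L2_norm_def)

lemma L2_approximable_add:
  assumes "\<And>i. i \<in> I \<Longrightarrow> E i \<in> L2" "g \<in> L2" "h \<in> L2" "L2_approximable I E g" "L2_approximable I E h"
  shows "L2_approximable I E (\<lambda>x. g x + h x)"
  unfolding L2_approximable_def
proof (intro allI impI)
  fix \<epsilon> :: real
  assume "\<epsilon> > 0"
  then have \<epsilon>: "\<epsilon> / 2 > 0"
    by simp
  obtain A c where A: "finite A" "A \<subseteq> I" "L2_norm (\<lambda>x. g x - (\<Sum>i\<in>A. c i * E i x)) < \<epsilon> / 2"
    using L2_approximableE[OF assms(4) \<epsilon>] by blast
  obtain B d where B: "finite B" "B \<subseteq> I" "L2_norm (\<lambda>x. h x - (\<Sum>i\<in>B. d i * E i x)) < \<epsilon> / 2"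
    using L2_approximableE[OF assms(5) \<epsilon>] by blast
  \<comment> \<open>Extending both coefficient families by zero puts the two combinations on one
    index set, where overlapping terms can be added.\<close>
  define c' where "c' = (\<lambda>i. if i \<in> A then c i else 0)"
  define d' where "d' = (\<lambda>i. if i \<in> B then d i else 0)"
  have "(\<Sum>i\<in>A \<union> B. c' i * E i x) = (\<Sum>i\<in>A. c i * E i x)" for x
    by (intro sum.mono_neutral_cong_right) (use A B in \<open>auto simp: c'_def\<close>)
  moreover have "(\<Sum>i\<in>A \<union> B. d' i * E i x) = (\<Sum>i\<in>B. d i * E i x)" for x
    by (intro sum.mono_neutral_cong_right) (use A B in \<open>auto simp: d'_def\<close>)
  ultimately have "(\<lambda>x. (g x + h x) - (\<Sum>i\<in>A \<union> B. (c' i + d' i) * E i x))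
     = (\<lambda>x. (g x - (\<Sum>i\<in>A. c i * E i x)) + (h x - (\<Sum>i\<in>B. d i * E i x)))"
    by (simp add: distrib_right sum.distrib algebra_simps)
  moreover have "L2_norm (\<lambda>x. (g x - (\<Sum>i\<in>A. c i * E i x)) + (h x - (\<Sum>i\<in>B. d i * E i x)))
    \<le> L2_norm (\<lambda>x. g x - (\<Sum>i\<in>A. c i * E i x)) + L2_norm (\<lambda>x. h x - (\<Sum>i\<in>B. d i * E i x))"
    by (intro L2_norm_triangle L2_diff L2_sum L2_cmult assms) (use A B in auto)
  ultimately have "L2_norm (\<lambda>x. (g x + h x) - (\<Sum>i\<in>A \<union> B. (c' i + d' i) * E i x)) < \<epsilon>"
    using A(3) B(3) by simp
  then show "\<exists>A c. finite A \<and> A \<subseteq> I \<and> L2_norm (\<lambda>x. (g x + h x) - (\<Sum>i\<in>A. c i * E i x)) < \<epsilon>"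
    using A B by (intro exI[of _ "A \<union> B"] exI[of _ "\<lambda>i. c' i + d' i"]) auto
qed

lemma L2_approximable_sum:
  assumes "\<And>i. i \<in> I \<Longrightarrow> E i \<in> L2" "\<And>k. k \<in> K \<Longrightarrow> g k \<in> L2" "\<And>k. k \<in> K \<Longrightarrow> L2_approximable I E (g k)"
  shows "L2_approximable I E (\<lambda>x. \<Sum>k\<in>K. g k x)"
  using assms(2,3)
proof (induction K rule: infinite_finite_induct)
  case (insert k K)
  then show ?case
    by (simp add: L2_approximable_add[OF assms(1)] L2_sum)
qed (simp_all add: L2_approximable_zero)

lemma L2_approximable_limit:
  assumes "\<And>i. i \<in> I \<Longrightarrow> E i \<in> L2" "L2_tendsto F g" "\<And>k. L2_approximable I E (F k)"
  shows "L2_approximable I E g"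
  unfolding L2_approximable_def
proof (intro allI impI)
  fix \<epsilon> :: real
  assume "\<epsilon> > 0"
  then have \<epsilon>: "\<epsilon> / 2 > 0"
    by simp
  obtain k where k: "F k \<in> L2" "L2_norm (\<lambda>x. g x - F k x) < \<epsilon> / 2"
    using L2_tendsto_approx[OF assms(2) \<epsilon>] by blast
  obtain A c where A: "finite A" "A \<subseteq> I" "L2_norm (\<lambda>x. F k x - (\<Sum>i\<in>A. c i * E i x)) < \<epsilon> / 2"
    using L2_approximableE[OF assms(3) \<epsilon>] by blast
  have "g \<in> L2"
    using assms(2) by (simp add: L2_tendsto_def)
  then have "L2_norm (\<lambda>x. g x - (\<Sum>i\<in>A. c i * E i x))
    \<le> L2_norm (\<lambda>x. g x - F k x) + L2_norm (\<lambda>x. F k x - (\<Sum>i\<in>A. c i * E i x))"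
    by (intro L2_norm_triangle_diff L2_sum L2_cmult assms k) (use A in auto)
  then show "\<exists>A c. finite A \<and> A \<subseteq> I \<and> L2_norm (\<lambda>x. g x - (\<Sum>i\<in>A. c i * E i x)) < \<epsilon>"
    using A k by (intro exI[of _ A] exI[of _ c]) auto
qed

text \<open>Orthonormality is Parseval's formula divided by \<open>2 * pi\<close>. For density,
  cutting f off makes its transform available as an integral, and the norm identity turns an
  approximation of that transform into one of the cut-off function.\<close>

lemma orthonormal_basis_L2_fourier:
  assumes four: "\<And>i. i \<in> I \<Longrightarrow> has_fourier_L2 (e i) (E i)"
    and orth: "\<And>i k. i \<in> I \<Longrightarrow> k \<in> I \<Longrightarrow> L2_inner (E i) (E k) = (if i = k then 2 * pi else 0)"
    and dense: "\<And>g. g \<in> L2 \<Longrightarrow> L2_approximable I E g"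
  shows "orthonormal_basis_L2 I e"
  unfolding orthonormal_basis_L2_def
proof (intro conjI ballI allI impI)
  fix i assume "i \<in> I"
  then show "e i \<in> L2"
    using four has_fourier_L2_L2 by blast
next
  fix i k assume ik: "i \<in> I" "k \<in> I"
  show "L2_inner (e i) (e k) = (if i = k then 1 else 0)"
    using Parseval_L2[OF four[OF ik(1)] four[OF ik(2)]] orth[OF ik] by (simp split: if_splits)
next
  fix f and \<epsilon> :: real
  assume f: "f \<in> L2" and \<epsilon>: "\<epsilon> > 0"
  obtain k :: nat where k: "(\<lambda>x. if \<bar>x\<bar> < real k then f x else 0) \<in> L2"
    "L2_norm (\<lambda>x. f x - (if \<bar>x\<bar> < real k then f x else 0)) < \<epsilon> / 2"
    using L2_approx_support[OF f, of "\<epsilon> / 2"] \<epsilon> by auto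
  define h where "h = (\<lambda>x. if \<bar>x\<bar> < real k then f x else 0)"
  have hL2: "h \<in> L2"
    using k by (simp add: h_def)
  have h1: "integrable lborel h"
  proof -
    have [measurable]: "h \<in> borel_measurable borel"
      using hL2 by (rule L2_measurable)
    \<comment> \<open>A square-integrable function of bounded support is integrable, being its
      product with a square-integrable indicator.\<close>
    have "(\<lambda>x. complex_of_real (indicator {-real k..real k} x)) \<in> L2"
      by (rule L2_bounded_support[of _ 1 "-real k" "real k"]) (auto simp: indicator_def)
    from L2_integrable_mult[OF hL2 this] show ?thesis
      by (rule Bochner_Integration.integrable_cong[THEN iffD1, OF refl, rotated]) (auto simp: h_def indicator_def)
  qed
  have hF: "has_fourier_L2 h (fourier_L1 h)"
    by (rule has_fourier_L2_L1[OF h1 hL2])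
  \<comment> \<open>The factor \<open>sqrt (2 * pi)\<close> in the tolerance is the one by which the
    transform enlarges norms.\<close>
  obtain A c where A: "finite A" "A \<subseteq> I"
    "L2_norm (\<lambda>x. fourier_L1 h x - (\<Sum>i\<in>A. c i * E i x)) < sqrt (2 * pi) * (\<epsilon> / 2)"
    using L2_approximableE[OF dense[OF has_fourier_L2_L2(2)[OF hF]], of "sqrt (2 * pi) * (\<epsilon> / 2)"] \<epsilon> by auto
  have sumF: "has_fourier_L2 (\<lambda>x. \<Sum>i\<in>A. c i * e i x) (\<lambda>x. \<Sum>i\<in>A. c i * E i x)"
    using A(2) by (intro has_fourier_L2_sum has_fourier_L2_cmult four) auto
  have "L2_norm (\<lambda>x. h x - (\<Sum>i\<in>A. c i * e i x)) < \<epsilon> / 2"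
    using A(3) unfolding has_fourier_L2_norm[OF has_fourier_L2_diff[OF hF sumF]] by simp
  then have "L2_norm (\<lambda>x. f x - (\<Sum>i\<in>A. c i * e i x)) < \<epsilon>"
    using L2_norm_triangle_diff[OF f hL2 has_fourier_L2_L2(1)[OF sumF]] k(2) by (simp add: h_def)
  then show "\<exists>A c. finite A \<and> A \<subseteq> I \<and> L2_norm (\<lambda>x. f x - (\<Sum>i\<in>A. c i * e i x)) < \<epsilon>"
    using A by blast
qed

section \<open>Trigonometric polynomials\<close>

definition trig_poly :: "(real \<Rightarrow> complex) \<Rightarrow> bool" where
  "trig_poly P \<longleftrightarrow> (\<exists>A c. finite A \<and> P = (\<lambda>t. \<Sum>n\<in>A. c n * cis (real_of_int n * t)))"

lemma trig_poly_monomial: "trig_poly (\<lambda>t. a * cis (real_of_int n * t))"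
  unfolding trig_poly_def by (intro exI[of _ "{n}"] exI[of _ "\<lambda>_. a"]) auto

lemma trig_poly_const: "trig_poly (\<lambda>t. a)"
  using trig_poly_monomial[of a 0] by simp

lemma trig_poly_add:
  assumes "trig_poly P" "trig_poly Q"
  shows "trig_poly (\<lambda>t. P t + Q t)"
proof -
  obtain A c where A: "finite A" "P = (\<lambda>t. \<Sum>n\<in>A. c n * cis (real_of_int n * t))"
    using assms(1) by (auto simp: trig_poly_def)
  obtain B d where B: "finite B" "Q = (\<lambda>t. \<Sum>n\<in>B. d n * cis (real_of_int n * t))"
    using assms(2) by (auto simp: trig_poly_def)
  define c' where "c' = (\<lambda>i. if i \<in> A then c i else 0)"
  define d' where "d' = (\<lambda>i. if i \<in> B then d i else 0)"
  have "(\<Sum>i\<in>A \<union> B. c' i * cis (real_of_int i * t)) = P t" for t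
    unfolding A by (intro sum.mono_neutral_cong_right) (use A B in \<open>auto simp: c'_def\<close>)
  moreover have "(\<Sum>i\<in>A \<union> B. d' i * cis (real_of_int i * t)) = Q t" for t
    unfolding B by (intro sum.mono_neutral_cong_right) (use A B in \<open>auto simp: d'_def\<close>)
  ultimately have "(\<lambda>t. P t + Q t) = (\<lambda>t. \<Sum>i\<in>A \<union> B. (c' i + d' i) * cis (real_of_int i * t))"
    by (simp add: distrib_right sum.distrib)
  then show ?thesis
    unfolding trig_poly_def using A B by (intro exI[of _ "A \<union> B"] exI[of _ "\<lambda>i. c' i + d' i"]) auto
qed

lemma trig_poly_sum: "(\<And>i. i \<in> A \<Longrightarrow> trig_poly (P i)) \<Longrightarrow> trig_poly (\<lambda>t. \<Sum>i\<in>A. P i t)"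
  by (induction A rule: infinite_finite_induct) (auto intro: trig_poly_const trig_poly_add)

lemma trig_poly_mult:
  assumes "trig_poly P" "trig_poly Q"
  shows "trig_poly (\<lambda>t. P t * Q t)"
proof -
  obtain A c where A: "finite A" "P = (\<lambda>t. \<Sum>n\<in>A. c n * cis (real_of_int n * t))"
    using assms(1) by (auto simp: trig_poly_def)
  obtain B d where B: "finite B" "Q = (\<lambda>t. \<Sum>n\<in>B. d n * cis (real_of_int n * t))"
    using assms(2) by (auto simp: trig_poly_def)
  have eq: "c n * cis (real_of_int n * t) * (d m * cis (real_of_int m * t))
      = (c n * d m) * cis (real_of_int (n + m) * t)" for n m t
    by (simp add: distrib_right flip: cis_mult)
  have "P t * Q t = (\<Sum>n\<in>A. \<Sum>m\<in>B. (c n * d m) * cis (real_of_int (n + m) * t))" for t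
    unfolding A B sum_product eq ..
  then show ?thesis
    by (simp only:) (intro trig_poly_sum trig_poly_monomial)
qed

lemma trig_poly_shift:
  assumes "trig_poly P"
  shows "trig_poly (\<lambda>t. P (t - a))"
proof -
  obtain A c where A: "finite A" "P = (\<lambda>t. \<Sum>n\<in>A. c n * cis (real_of_int n * t))"
    using assms(1) by (auto simp: trig_poly_def)
  have "P (t - a) = (\<Sum>n\<in>A. (c n * cis (- (real_of_int n * a))) * cis (real_of_int n * t))" for t
    unfolding A by (intro sum.cong refl) (simp add: cis_mult algebra_simps)
  then show ?thesis
    using trig_poly_monomial by (auto intro!: trig_poly_sum)
qed

lemma cis_int_periodic: "cis (real_of_int n * (t + 2 * pi * real_of_int k)) = cis (real_of_int n * t)"
proof -
  have "cis (real_of_int n * (t + 2 * pi * real_of_int k))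
      = cis (real_of_int n * t) * cis (2 * pi * real_of_int (n * k))"
    by (simp add: cis_mult algebra_simps)
  also have "cis (2 * pi * real_of_int (n * k)) = 1"
    by (rule cis_multiple_2pi) simp
  finally show ?thesis
    by simp
qed

lemma trig_poly_periodic:
  assumes "trig_poly P"
  shows "P (t + 2 * pi * real_of_int k) = P t"
  using assms cis_int_periodic by (auto simp: trig_poly_def)

lemma trig_poly_continuous: "trig_poly P \<Longrightarrow> continuous_on S P"
  by (auto simp: trig_poly_def intro!: continuous_intros)

lemma trig_poly_measurable: "trig_poly P \<Longrightarrow> P \<in> borel_measurable borel"
  by (intro borel_measurable_continuous_onI trig_poly_continuous)

text \<open>Sums and products preserve trigonometric polynomials, so only real linear forms need
  work: on the circle they are combinations of cos and sin, which Euler's formula expresses through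
  frequencies 1 and -1.\<close>

lemma trig_poly_real_polynomial:
  fixes p :: "complex \<Rightarrow> real"
  assumes "real_polynomial_function p"
  shows "trig_poly (\<lambda>t. complex_of_real (p (cis t)))"
  using assms
proof induction
  case (linear f)
  then interpret bounded_linear f .
  have "f (cis t) = f (cos t *\<^sub>R 1 + sin t *\<^sub>R \<i>)" for t
    by (rule arg_cong[of _ _ f]) (simp add: complex_eq_iff)
  then have "f (cis t) = cos t * f 1 + sin t * f \<i>" for t
    by (simp only: add scaleR real_scaleR_def)
  then have "complex_of_real (f (cis t)) = ((f 1 - \<i> * f \<i>) / 2) * cis (real_of_int 1 * t)
      + ((f 1 + \<i> * f \<i>) / 2) * cis (real_of_int (-1) * t)" for t
    by (simp add: complex_eq_iff field_simps)
  then show ?case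
    by (simp only:) (intro trig_poly_add trig_poly_monomial)
qed (auto intro: trig_poly_const trig_poly_add trig_poly_mult)

lemma trig_poly_polynomial:
  fixes p :: "complex \<Rightarrow> complex"
  assumes "polynomial_function p"
  shows "trig_poly (\<lambda>t. p (cis t))"
proof -
  have "real_polynomial_function (Re \<circ> p)" "real_polynomial_function (Im \<circ> p)"
    using assms bounded_linear_Re bounded_linear_Im by (auto simp: polynomial_function_def)
  from this[THEN trig_poly_real_polynomial]
  have "trig_poly (\<lambda>t. complex_of_real (Re (p (cis t))) + \<i> * complex_of_real (Im (p (cis t))))"
    by (intro trig_poly_add trig_poly_mult[OF trig_poly_const]) auto
  then show ?thesis
    by (simp flip: complex_eq)
qed

text \<open>Equal end values let f descend to a continuous function on the unit circle, where
  Stone-Weierstrass gives a polynomial; polynomials restricted to the circle are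
  trigonometric.\<close>

lemma trig_poly_uniform_approx:
  fixes f :: "real \<Rightarrow> complex"
  assumes "continuous_on {0..2 * pi} f" "f 0 = f (2 * pi)" "\<epsilon> > 0"
  obtains P where "trig_poly P" "\<And>t. t \<in> {0..2 * pi} \<Longrightarrow> cmod (f t - P t) < \<epsilon>"
proof -
  define p where "p = (\<lambda>s. f (2 * pi * s))"
  have "continuous_on {0..1} p"
    unfolding p_def by (intro continuous_on_compose2[OF assms(1)] continuous_intros) auto
  \<comment> \<open>The delicate point is continuity at 1, where the argument jumps. It is read off
    from the constant homotopy of the loop p, since passing from loops to circle maps produces
    exactly the composition with the normalised argument.\<close>
  then have "homotopic_loops UNIV p p"
    using assms(2) by (simp add: homotopic_loops_refl path_def pathfinish_def pathstart_def p_def)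
  then have "continuous_on (sphere 0 1) (p \<circ> (\<lambda>z. Arg2pi z / (2 * pi)))"
    by (intro homotopic_with_imp_continuous[THEN conjunct1, OF homotopic_loops_imp_homotopic_circlemaps])
  then obtain g where g: "polynomial_function g"
    "\<And>z. z \<in> sphere 0 1 \<Longrightarrow> cmod ((p \<circ> (\<lambda>z. Arg2pi z / (2 * pi))) z - g z) < \<epsilon>"
    using Stone_Weierstrass_polynomial_function[OF compact_sphere _ assms(3)] by metis
  have "cmod (f t - g (cis t)) < \<epsilon>" if "t \<in> {0..2 * pi}" for t
  proof -
    have "f (Arg2pi (cis t)) = f t"
    \<comment> \<open>The argument takes values below \<open>2 * pi\<close>, so the right end point
      is sent to 0 and the equality of the end values is used.\<close>
    proof (cases "t = 2 * pi")
      case True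
      have "Arg2pi 1 = 0"
        by (simp add: Arg2pi_eq_0)
      then show ?thesis
        using True assms(2) by simp
    next
      case False
      then have "Arg2pi (cis t) = t"
        using that by (intro Arg2pi_unique[of 1]) (auto simp: cis_conv_exp)
      then show ?thesis
        by simp
    qed
    then show ?thesis
      using g(2)[of "cis t"] by (simp add: p_def)
  qed
  with trig_poly_polynomial[OF g(1)] show thesis
    by (rule that)
qed

lemma L2_norm_bounded_support_le:
  assumes "f \<in> borel_measurable borel" "\<And>x. cmod (f x) \<le> B" "\<And>x. x \<notin> {a..b} \<Longrightarrow> f x = 0" "a \<le> b"
  shows "L2_norm f \<le> B * sqrt (b - a)"
proof -
  have B: "B \<ge> 0"
    using assms(2)[of 0] norm_ge_zero order_trans by blast
  have "(LINT x|lborel. (cmod (f x))\<^sup>2) \<le> (LINT x|lborel. B\<^sup>2 * indicator {a..b} x)"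
  proof (rule integral_mono)
    show "integrable lborel (\<lambda>x. (cmod (f x))\<^sup>2)"
      by (intro L2_integrable L2_bounded_support[of f B a b] assms)
    show "integrable lborel (\<lambda>x. B\<^sup>2 * indicator {a..b} x :: real)"
      by (intro integrable_mult_right integrable_real_indicator) (auto simp: emeasure_lborel_Icc_eq)
    show "(cmod (f x))\<^sup>2 \<le> B\<^sup>2 * indicator {a..b} x" for x
      using assms(3)[of x] power_mono[OF assms(2)[of x], of 2] by (cases "x \<in> {a..b}") auto
  qed
  also have "\<dots> = B\<^sup>2 * (b - a)"
    using assms(4) by simp
  finally have "L2_norm f \<le> sqrt (B\<^sup>2 * (b - a))"
    unfolding L2_norm_def by (rule real_sqrt_le_mono)
  then show ?thesis
    using B by (simp add: real_sqrt_mult)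
qed

lemma L2_norm_cong_AE:
  assumes "f \<in> borel_measurable borel" "g \<in> borel_measurable borel" "AE x in lborel. f x = g x"
  shows "L2_norm f = L2_norm g"
  unfolding L2_norm_def using assms by (intro arg_cong[of _ _ sqrt] integral_cong_AE) auto

text \<open>A continuous approximant that vanishes at both ends of the period has matching end
  values, so the uniform approximation applies; on an interval of finite length it is also an
  approximation in norm.\<close>

lemma trig_poly_L2_approx:
  assumes h: "h \<in> L2" "\<And>t. t \<notin> {a..<a + 2 * pi} \<Longrightarrow> h t = 0" and \<epsilon>: "\<epsilon> > 0"
  obtains P where "trig_poly P" "L2_norm (\<lambda>t. h t - indicator {a..<a + 2 * pi} t * P t) < \<epsilon>"
proof -
  \<comment> \<open>Changing the value at the single point 0 makes the support lie in the open
    period, as the continuous approximation requires.\<close>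
  define g where "g = (\<lambda>t. if t = 0 then 0 else h (a + t))"
  have [measurable]: "h \<in> borel_measurable borel"
    using h by (auto dest: L2_measurable)
  have g_meas [measurable]: "g \<in> borel_measurable borel"
    unfolding g_def by measurable
  have g: "g \<in> L2"
    by (rule L2_bound[OF g_meas L2_affine[OF h(1), of 1 a]]) (auto simp: g_def)
  have "g t = 0" if "t \<notin> {0<..<2 * pi}" for t
    using that h(2)[of "a + t"] by (auto simp: g_def)
  then obtain c B where c: "continuous_on UNIV c" "c \<in> L2" "\<And>x. x \<notin> {0<..<2 * pi} \<Longrightarrow> c x = 0"
    "L2_norm (\<lambda>x. g x - c x) < \<epsilon> / 2"
    using L2_approx_continuous[OF g, of 0 "2 * pi" "\<epsilon> / 2"] \<epsilon> by (metis half_gt_zero)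
  have [measurable]: "c \<in> borel_measurable borel"
    using c by (auto dest: L2_measurable)
  \<comment> \<open>A uniform error \<delta> on an interval of length \<open>2 * pi\<close> costs at
    most \<delta> times \<open>sqrt (2 * pi)\<close> in norm.\<close>
  define \<delta> where "\<delta> = \<epsilon> / 2 / sqrt (2 * pi)"
  have "\<delta> > 0"
    using \<epsilon> by (simp add: \<delta>_def)
  then obtain P where P: "trig_poly P" "\<And>t. t \<in> {0..2 * pi} \<Longrightarrow> cmod (c t - P t) < \<delta>"
    using trig_poly_uniform_approx[of c \<delta>] c continuous_on_subset[OF c(1)] by auto
  have [measurable]: "P \<in> borel_measurable borel"
    using P(1) by (rule trig_poly_measurable)
  have PL2: "(\<lambda>t. indicator {0..<2 * pi} t * P t) \<in> L2"
  proof -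
    have "(\<lambda>t. c t - indicator {0..<2 * pi} t * P t) \<in> L2"
      by (rule L2_bounded_support[of _ \<delta> 0 "2 * pi"])
         (use P(2) c(3) \<open>\<delta> > 0\<close> in \<open>auto simp: indicator_def less_imp_le\<close>)
    from L2_diff[OF c(2) this] show ?thesis
      by simp
  qed
  have "L2_norm (\<lambda>t. c t - indicator {0..<2 * pi} t * P t) \<le> \<delta> * sqrt (2 * pi - 0)"
    by (rule L2_norm_bounded_support_le)
       (use P(2) c(3) \<open>\<delta> > 0\<close> in \<open>auto simp: indicator_def less_imp_le\<close>)
  also have "\<dots> = \<epsilon> / 2"
    by (simp add: \<delta>_def)
  finally have "L2_norm (\<lambda>t. g t - indicator {0..<2 * pi} t * P t) < \<epsilon>"
    using L2_norm_triangle_diff[OF g c(2) PL2] c(4) by simp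
  also have "L2_norm (\<lambda>t. g t - indicator {0..<2 * pi} t * P t)
      = L2_norm (\<lambda>t. h (a + 1 * t) - indicator {a..<a + 2 * pi} (a + 1 * t) * P ((a + 1 * t) - a))"
  proof (rule L2_norm_cong_AE)
    show "AE t in lborel. g t - indicator {0..<2 * pi} t * P t
        = h (a + 1 * t) - indicator {a..<a + 2 * pi} (a + 1 * t) * P ((a + 1 * t) - a)"
      using AE_lborel_singleton[of 0]
    proof eventually_elim
      case (elim t)
      then show ?case
        by (simp add: g_def indicator_def)
    qed
  qed measurable
  also have "\<dots> = L2_norm (\<lambda>t. h t - indicator {a..<a + 2 * pi} t * P (t - a))"
    by (subst L2_norm_affine) auto
  finally show thesis
    using that[OF trig_poly_shift[OF P(1)]] by blast
qed

section \<open>Exponentials on a symmetric frequency band\<close>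

lemma trig_poly_bounded:
  assumes "trig_poly P"
  obtains B where "\<And>t. cmod (P t) \<le> B"
proof -
  obtain A c where A: "finite A" "P = (\<lambda>t. \<Sum>n\<in>A. c n * cis (real_of_int n * t))"
    using assms(1) by (auto simp: trig_poly_def)
  have "cmod (P t) \<le> (\<Sum>n\<in>A. cmod (c n))" for t
    unfolding A by (rule order_trans[OF norm_sum]) (simp add: norm_mult)
  then show thesis
    by (rule that)
qed

definition freq_band :: "int \<Rightarrow> real set" where
  "freq_band k = {t. real_of_int k * pi \<le> \<bar>t\<bar> \<and> \<bar>t\<bar> < real_of_int (k + 1) * pi}"

lemma freq_band_measurable [measurable]: "freq_band k \<in> sets borel"
  unfolding freq_band_def by measurable

lemma freq_band_subset: "freq_band k \<subseteq> {- (real_of_int (k + 1) * pi)..real_of_int (k + 1) * pi}"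
  by (auto simp: freq_band_def)

text \<open>
  Shifting the negative half of the band by \<open>2 * pi * (k + 1)\<close> places it directly to the right of the
  positive half, up to end points.
\<close>
lemma integral_freq_band:
  fixes u :: "real \<Rightarrow> 'a :: {banach, second_countable_topology}"
  assumes k: "k \<ge> 1" and [measurable]: "u \<in> borel_measurable borel"
    and u: "integrable lborel (\<lambda>t. indicator (freq_band k) t *\<^sub>R u t)"
  defines "a \<equiv> real_of_int k * pi"
  shows "(LINT t|lborel. indicator (freq_band k) t *\<^sub>R u t)
    = (LINT t|lborel. indicator {a..<a + pi} t *\<^sub>R u t
        + indicator {a + pi..<a + 2 * pi} t *\<^sub>R u (t - 2 * pi * real_of_int (k + 1)))"
proof -
  define b where "b = 2 * pi * real_of_int (k + 1)"
  have a: "a > 0"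
    using k by (simp add: a_def)
  have ab: "b = 2 * a + 2 * pi"
    by (simp add: a_def b_def algebra_simps)
  have band: "freq_band k = {t. a \<le> \<bar>t\<bar> \<and> \<bar>t\<bar> < a + pi}"
    by (simp add: freq_band_def a_def algebra_simps)
  have pos: "integrable lborel (\<lambda>t. indicator {a..<a + pi} t *\<^sub>R u t)"
    by (rule Bochner_Integration.integrable_cong[THEN iffD1, OF refl _ integrable_mult_indicator[OF _ u, of "{0..}"]])
       (use a in \<open>auto simp: band indicator_def\<close>)
  have neg0: "integrable lborel (\<lambda>t. indicator {..<0} t *\<^sub>R indicator (freq_band k) t *\<^sub>R u t)"
    by (rule integrable_mult_indicator[OF _ u]) simp
  have neg1: "integrable lborel (\<lambda>t. indicator {-a - pi<..-a} t *\<^sub>R u t)"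
    by (rule Bochner_Integration.integrable_cong[THEN iffD1, OF refl _ neg0])
       (use a in \<open>auto simp: band indicator_def\<close>)
  \<comment> \<open>The negative half of the band is closed on its right. Switching the closed end,
    a null change, makes its translate abut the positive half as a half-open interval.\<close>
  have ae: "AE t in lborel. indicator {-a - pi<..-a} t *\<^sub>R u t = indicator {-a - pi..<-a} t *\<^sub>R u t"
    using AE_lborel_singleton[of "-a - pi"] AE_lborel_singleton[of "-a"]
    by eventually_elim (auto simp: indicator_def)
  then have neg: "integrable lborel (\<lambda>t. indicator {-a - pi..<-a} t *\<^sub>R u t)"
    by (rule integrable_cong_AE[THEN iffD1, rotated 2, OF _ neg1]) measurable
  have shifted: "(\<lambda>t. indicator {-a - pi..<-a} (-b + 1 * t) *\<^sub>R u (-b + 1 * t))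
      = (\<lambda>t. indicator {a + pi..<a + 2 * pi} t *\<^sub>R u (t - b))"
  proof
    fix t
    have "-b + 1 * t = t - b" by simp
    then show "indicator {-a - pi..<-a} (-b + 1 * t) *\<^sub>R u (-b + 1 * t)
      = indicator {a + pi..<a + 2 * pi} t *\<^sub>R u (t - b)"
      by (auto simp only:) (auto simp: ab indicator_def)
  qed
  have "(LINT t|lborel. indicator (freq_band k) t *\<^sub>R u t)
      = (LINT t|lborel. indicator {a..<a + pi} t *\<^sub>R u t + indicator {-a - pi<..-a} t *\<^sub>R u t)"
    by (intro Bochner_Integration.integral_cong refl) (use a in \<open>auto simp: band indicator_def\<close>)
  also have "\<dots> = (LINT t|lborel. indicator {a..<a + pi} t *\<^sub>R u t) + (LINT t|lborel. indicator {-a - pi<..-a} t *\<^sub>R u t)"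
    using pos neg1 by simp
  also have "(LINT t|lborel. indicator {-a - pi<..-a} t *\<^sub>R u t) = (LINT t|lborel. indicator {-a - pi..<-a} t *\<^sub>R u t)"
    by (intro integral_cong_AE ae) measurable
  also have "\<dots> = (LINT t|lborel. indicator {a + pi..<a + 2 * pi} t *\<^sub>R u (t - b))"
    using lborel_integral_real_affine[of 1 "\<lambda>t. indicator {-a - pi..<-a} t *\<^sub>R u t" "-b"]
    unfolding shifted by simp
  also have "(LINT t|lborel. indicator {a..<a + pi} t *\<^sub>R u t) + \<dots>
      = (LINT t|lborel. indicator {a..<a + pi} t *\<^sub>R u t + indicator {a + pi..<a + 2 * pi} t *\<^sub>R u (t - b))"
    using pos lborel_integrable_real_affine[OF neg, of 1 "-b"] unfolding shifted by simp
  finally show ?thesis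
    by (simp add: b_def)
qed

lemma indicator_trig_poly_L2:
  assumes "trig_poly P" "S \<in> sets borel" "S \<subseteq> {a..b}"
  shows "(\<lambda>t. indicator S t * P t) \<in> L2"
proof -
  obtain B where B: "\<And>t. cmod (P t) \<le> B"
    using trig_poly_bounded[OF assms(1)] by blast
  have "B \<ge> 0"
    using B[of 0] norm_ge_zero order_trans by blast
  have [measurable]: "P \<in> borel_measurable borel" "S \<in> sets borel"
    using assms trig_poly_measurable by auto
  show ?thesis
    by (rule L2_bounded_support[of _ B a b]) (use B \<open>B \<ge> 0\<close> assms(3) in \<open>auto simp: indicator_def\<close>)
qed

text \<open>Rearranging h onto one full period is an isometry, and a trigonometric polynomial is
  unchanged by the translation involved; an approximation on the period is therefore equally good on
  the band.\<close>

lemma freq_band_trig_approx: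
  assumes k: "k \<ge> 1" and h: "h \<in> L2" "\<And>t. t \<notin> freq_band k \<Longrightarrow> h t = 0" and \<epsilon>: "\<epsilon> > 0"
  obtains P where "trig_poly P" "L2_norm (\<lambda>t. h t - indicator (freq_band k) t * P t) < \<epsilon>"
proof -
  define a where "a = real_of_int k * pi"
  define b where "b = 2 * pi * real_of_int (k + 1)"
  have [measurable]: "h \<in> borel_measurable borel"
    using h by (auto dest: L2_measurable)
  define H where "H = (\<lambda>t. indicator {a..<a + pi} t * h t + indicator {a + pi..<a + 2 * pi} t * h (t - b))"
  have "H \<in> L2"
    unfolding H_def
  proof (rule L2_add)
    show "(\<lambda>t. indicator {a..<a + pi} t * h t) \<in> L2"
      by (rule L2_bound[OF _ h(1)]) (auto simp: indicator_def)
    show "(\<lambda>t. indicator {a + pi..<a + 2 * pi} t * h (t - b)) \<in> L2"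
      by (rule L2_bound[OF _ L2_affine[OF h(1), of 1 "-b"]]) (auto simp: indicator_def)
  qed
  moreover have "H t = 0" if "t \<notin> {a..<a + 2 * pi}" for t
    using that by (auto simp: H_def indicator_def)
  ultimately obtain P where P: "trig_poly P" "L2_norm (\<lambda>t. H t - indicator {a..<a + 2 * pi} t * P t) < \<epsilon>"
    using trig_poly_L2_approx[of H a \<epsilon>] \<epsilon> by auto
  have per: "P (t - b) = P t" for t
    using trig_poly_periodic[OF P(1), of "t - b" "k + 1"] by (simp add: b_def)
  define u where "u = (\<lambda>t. (cmod (h t - P t))\<^sup>2)"
  have sq: "(cmod (h t - indicator (freq_band k) t * P t))\<^sup>2 = indicator (freq_band k) t *\<^sub>R u t" for t
    using h(2)[of t] by (auto simp: u_def indicator_def)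
  have "(\<lambda>t. h t - indicator (freq_band k) t * P t) \<in> L2"
    by (intro L2_diff h indicator_trig_poly_L2[OF P(1) _ freq_band_subset]) measurable
  then have "integrable lborel (\<lambda>t. indicator (freq_band k) t *\<^sub>R u t)"
    unfolding sq[symmetric] by (rule L2_integrable)
  moreover have "u \<in> borel_measurable borel"
    using trig_poly_measurable[OF P(1)] unfolding u_def by measurable
  ultimately have "(LINT t|lborel. (cmod (h t - indicator (freq_band k) t * P t))\<^sup>2)
      = (LINT t|lborel. indicator {a..<a + pi} t *\<^sub>R u t + indicator {a + pi..<a + 2 * pi} t *\<^sub>R u (t - b))"
    unfolding sq a_def b_def by (intro integral_freq_band k)
  also have "(\<lambda>t. indicator {a..<a + pi} t *\<^sub>R u t + indicator {a + pi..<a + 2 * pi} t *\<^sub>R u (t - b))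
      = (\<lambda>t. (cmod (H t - indicator {a..<a + 2 * pi} t * P t))\<^sup>2)"
    by (auto simp: u_def H_def per indicator_def fun_eq_iff)
  finally have "L2_norm (\<lambda>t. h t - indicator (freq_band k) t * P t)
     = L2_norm (\<lambda>t. H t - indicator {a..<a + 2 * pi} t * P t)"
    by (simp add: L2_norm_def)
  with P show thesis
    using that by simp
qed

lemma integral_cis_period:
  "(LINT t|lborel. indicator {a..<a + 2 * pi} t *\<^sub>R cis (real_of_int l * t)) = (if l = 0 then 2 * pi else 0)"
proof -
  have "(LINT t|lborel. indicator {a..<a + 2 * pi} t *\<^sub>R cis (real_of_int l * t))
      = (LINT t|lborel. indicator {a..a + 2 * pi} t *\<^sub>R cis (real_of_int l * t))"
  proof (rule integral_cong_AE)
    have "(\<lambda>t. cis (real_of_int l * t)) \<in> borel_measurable borel"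
      by (intro borel_measurable_continuous_onI continuous_intros)
    then show "(\<lambda>t. indicator {a..<a + 2 * pi} t *\<^sub>R cis (real_of_int l * t)) \<in> borel_measurable lborel"
      "(\<lambda>t. indicator {a..a + 2 * pi} t *\<^sub>R cis (real_of_int l * t)) \<in> borel_measurable lborel"
      by (auto intro!: borel_measurable_scaleR)
    show "AE t in lborel. indicator {a..<a + 2 * pi} t *\<^sub>R cis (real_of_int l * t)
        = indicator {a..a + 2 * pi} t *\<^sub>R cis (real_of_int l * t)"
      using AE_lborel_singleton[of "a + 2 * pi"] by eventually_elim (auto simp: indicator_def)
  qed
  also have "\<dots> = (if l = 0 then 2 * pi else 0)"
  proof (cases "l = 0")
    case True
    have "(LINT t|lborel. indicator {a..a + 2 * pi} t *\<^sub>R (1::complex))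
        = (\<lambda>t. complex_of_real t) (a + 2 * pi) - (\<lambda>t. complex_of_real t) a"
    proof (rule integral_FTC_atLeastAtMost)
      show "((\<lambda>t. complex_of_real t) has_vector_derivative 1) (at t within {a..a + 2 * pi})" for t
        unfolding has_vector_derivative_def
        by (auto intro!: derivative_eq_intros simp: scaleR_conv_of_real)
    qed auto
    then show ?thesis
      using True by simp
  next
    case False
    define F where "F = (\<lambda>t. cis (real_of_int l * t) / (\<i> * of_int l))"
    have "(LINT t|lborel. indicator {a..a + 2 * pi} t *\<^sub>R cis (real_of_int l * t)) = F (a + 2 * pi) - F a"
    proof (rule integral_FTC_atLeastAtMost)
      show "(F has_vector_derivative cis (real_of_int l * t)) (at t within {a..a + 2 * pi})" for t
      proof -
        have "((\<lambda>z. exp (\<i> * of_int l * z) / (\<i> * of_int l)) has_field_derivative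
            exp (\<i> * of_int l * complex_of_real t)) (at (complex_of_real t))"
          using False by (auto intro!: derivative_eq_intros)
        from has_vector_derivative_real_field[OF this] show ?thesis
          by (simp add: F_def cis_conv_exp mult_ac)
      qed
    qed (auto intro!: continuous_intros)
    also have "F (a + 2 * pi) = F a"
      using cis_int_periodic[of l a 1] by (simp add: F_def)
    finally show ?thesis
      using False by simp
  qed
  finally show ?thesis .
qed

lemma integral_freq_band_cis:
  assumes k: "k \<ge> 1"
  shows "(LINT t|lborel. indicator (freq_band k) t *\<^sub>R cis (real_of_int l * t)) = (if l = 0 then 2 * pi else 0)"
proof -
  define a where "a = real_of_int k * pi"
  have "(\<lambda>t. indicator (freq_band k) t * cis (real_of_int l * t)) \<in> L2"
    using trig_poly_monomial[of 1 l] by (intro indicator_trig_poly_L2[OF _ _ freq_band_subset]) auto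
  moreover have "(\<lambda>t. indicator (freq_band k) t * 1) \<in> L2"
    using trig_poly_const[of 1] by (intro indicator_trig_poly_L2[OF _ _ freq_band_subset]) auto
  ultimately have "integrable lborel (\<lambda>t. indicator (freq_band k) t * cis (real_of_int l * t) * cnj (indicator (freq_band k) t * 1))"
    by (rule L2_integrable_mult)
  also have "(\<lambda>t. indicator (freq_band k) t * cis (real_of_int l * t) * cnj (indicator (freq_band k) t * 1))
      = (\<lambda>t. indicator (freq_band k) t *\<^sub>R cis (real_of_int l * t))"
    by (auto simp: indicator_def)
  finally have "integrable lborel (\<lambda>t. indicator (freq_band k) t *\<^sub>R cis (real_of_int l * t))" .
  moreover have "(\<lambda>t. cis (real_of_int l * t)) \<in> borel_measurable borel"
    by (intro borel_measurable_continuous_onI continuous_intros)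
  ultimately have "(LINT t|lborel. indicator (freq_band k) t *\<^sub>R cis (real_of_int l * t))
    = (LINT t|lborel. indicator {a..<a + pi} t *\<^sub>R cis (real_of_int l * t)
      + indicator {a + pi..<a + 2 * pi} t *\<^sub>R cis (real_of_int l * (t - 2 * pi * real_of_int (k + 1))))"
    unfolding a_def by (intro integral_freq_band k)
  also have "\<dots> = (LINT t|lborel. indicator {a..<a + 2 * pi} t *\<^sub>R cis (real_of_int l * t))"
  proof (intro Bochner_Integration.integral_cong refl)
    fix t
    have "cis (real_of_int l * (t - 2 * pi * real_of_int (k + 1))) = cis (real_of_int l * t)"
      using cis_int_periodic[of l "t - 2 * pi * real_of_int (k + 1)" "k + 1"] by simp
    then show "indicator {a..<a + pi} t *\<^sub>R cis (real_of_int l * t)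
      + indicator {a + pi..<a + 2 * pi} t *\<^sub>R cis (real_of_int l * (t - 2 * pi * real_of_int (k + 1)))
      = indicator {a..<a + 2 * pi} t *\<^sub>R cis (real_of_int l * t)"
      by (auto simp: indicator_def)
  qed
  finally show ?thesis
    by (simp add: integral_cis_period)
qed

section \<open>Wavelets on the frequency side\<close>

locale rational_dilation =
  fixes p q :: int and M :: real
  assumes pq: "p > q" "q \<ge> 1" and M: "M = real_of_int p / real_of_int q"
begin

section \<open>Tiling of the nonzero frequencies by dilated bands\<close>

lemma M_gt_1: "M > 1"
  using pq by (simp add: M)

lemma q_mult_M: "real_of_int q * M = real_of_int p"
  using pq by (simp add: M)

text \<open>A dilation by M^(-j) followed by a translation by n q produces the phase n q M^j
  \<omega>. Absorbing q into the scale leaves the integer frequency n and turns the band ends,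
  multiples of pi / q, into multiples of pi.\<close>

definition scale :: "int \<Rightarrow> real" where
  "scale j = real_of_int q * M powi j"

lemma scale_pos: "scale j > 0"
  using pq M_gt_1 by (simp add: scale_def)

definition dilated_band :: "int \<Rightarrow> int \<Rightarrow> real set" where
  "dilated_band j m = {\<omega>. scale j * \<omega> \<in> freq_band (q + m - 1)}"

lemma dilated_band_measurable [measurable]: "dilated_band j m \<in> sets borel"
  unfolding dilated_band_def freq_band_def by measurable

lemma scale_gap:
  assumes "j < j'"
  shows "real_of_int p * scale j \<le> real_of_int q * scale j'"
proof -
  have "M powi j' = M powi j * M powi (j' - j)"
    using M_gt_1 by (simp flip: power_int_add)
  moreover have "M powi 1 \<le> M powi (j' - j)"
    using M_gt_1 assms by (intro power_int_increasing) auto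
  ultimately have "M powi j * M \<le> M powi j'"
    using M_gt_1 by (simp add: mult_left_mono)
  then have "real_of_int q * (real_of_int q * (M powi j * M)) \<le> real_of_int q * scale j'"
    using pq unfolding scale_def by (intro mult_left_mono) auto
  also have "real_of_int q * (real_of_int q * (M powi j * M)) = real_of_int p * scale j"
    by (simp add: scale_def mult_ac flip: q_mult_M)
  finally show ?thesis .
qed

lemma dilated_band_bounds:
  assumes "\<omega> \<in> dilated_band j m" "1 \<le> m" "m \<le> p - q"
  shows "real_of_int q * pi \<le> scale j * \<bar>\<omega>\<bar>" "scale j * \<bar>\<omega>\<bar> < real_of_int p * pi"
proof -
  have *: "real_of_int (q + m - 1) * pi \<le> scale j * \<bar>\<omega>\<bar>" "scale j * \<bar>\<omega>\<bar> < real_of_int (q + m) * pi"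
    using assms(1) scale_pos[of j] by (auto simp: dilated_band_def freq_band_def abs_mult)
  have "real_of_int q * pi \<le> real_of_int (q + m - 1) * pi"
    using assms(2) by (intro mult_right_mono) auto
  then show "real_of_int q * pi \<le> scale j * \<bar>\<omega>\<bar>"
    using * by linarith
  have "real_of_int (q + m) * pi \<le> real_of_int p * pi"
    using assms(3) by (intro mult_right_mono) auto
  then show "scale j * \<bar>\<omega>\<bar> < real_of_int p * pi"
    using * by linarith
qed

lemma dilated_band_level_le:
  assumes "\<omega> \<in> dilated_band j m" "1 \<le> m" "m \<le> p - q"
    and "\<omega> \<in> dilated_band j' m'" "1 \<le> m'" "m' \<le> p - q"
  shows "j' \<le> j"
proof (rule ccontr)
  assume "\<not> j' \<le> j"
  then have "real_of_int p * scale j * \<bar>\<omega>\<bar> \<le> real_of_int q * scale j' * \<bar>\<omega>\<bar>"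
    using scale_gap[of j j'] by (intro mult_right_mono) auto
  also have "\<dots> < real_of_int q * (real_of_int p * pi)"
    using dilated_band_bounds(2)[OF assms(4-6)] pq by (simp add: mult.assoc)
  also have "\<dots> \<le> real_of_int p * (scale j * \<bar>\<omega>\<bar>)"
    using mult_left_mono[OF dilated_band_bounds(1)[OF assms(1-3)], of "real_of_int p"] pq by (simp add: mult_ac)
  finally show False
    by simp
qed

lemma dilated_band_unique:
  assumes "\<omega> \<in> dilated_band j m" "1 \<le> m" "m \<le> p - q"
    and "\<omega> \<in> dilated_band j' m'" "1 \<le> m'" "m' \<le> p - q"
  shows "j = j'" "m = m'"
proof -
  show j: "j = j'"
    using dilated_band_level_le[OF assms] dilated_band_level_le[OF assms(4-6,1-3)] by simp
  \<comment> \<open>Two half-open unit intervals with integer left ends that share a point coincide;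
    both strict inequalities together express this.\<close>
  have "real_of_int (q + m - 1) * pi < real_of_int (q + m' - 1 + 1) * pi"
    "real_of_int (q + m' - 1) * pi < real_of_int (q + m - 1 + 1) * pi"
    using assms(1,4) unfolding dilated_band_def freq_band_def j mem_Collect_eq
    by (meson order_le_less_trans)+
  then have "real_of_int (q + m - 1) < real_of_int (q + m' - 1 + 1)"
    "real_of_int (q + m' - 1) < real_of_int (q + m - 1 + 1)"
    by (simp_all only: mult_less_cancel_right_pos[OF pi_gt_zero])
  then show "m = m'"
    by linarith
qed

lemma dilated_band_cover:
  assumes "\<omega> \<noteq> 0"
  obtains j m where "1 \<le> m" "m \<le> p - q" "\<omega> \<in> dilated_band j m"
proof -
  \<comment> \<open>Subtracting the integer part of this logarithm brings |\<omega>| M^j / pi into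
    the range from 1 (included) to M (excluded); multiplying by q then gives the range from q to
    p.\<close>
  define y where "y = log M (\<bar>\<omega>\<bar> / pi)"
  define j where "j = - \<lfloor>y\<rfloor>"
  have "M powr (y + real_of_int j) = \<bar>\<omega>\<bar> / pi * M powi j"
    using assms M_gt_1 by (simp add: powr_add y_def powr_real_of_int')
  moreover have "M powr 0 \<le> M powr (y + real_of_int j)"
    using M_gt_1 by (intro powr_mono) (auto simp: j_def)
  moreover have "M powr (y + real_of_int j) < M powr 1"
    using M_gt_1 by (intro powr_less_mono) (auto simp: j_def, linarith)
  ultimately have "1 \<le> \<bar>\<omega>\<bar> / pi * M powi j" "\<bar>\<omega>\<bar> / pi * M powi j < M"
    using M_gt_1 by auto
  then have "real_of_int q * 1 \<le> real_of_int q * (\<bar>\<omega>\<bar> / pi * M powi j)"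
    "real_of_int q * (\<bar>\<omega>\<bar> / pi * M powi j) < real_of_int q * M"
    using pq by (intro mult_left_mono mult_strict_left_mono; simp)+
  then have x: "real_of_int q \<le> scale j * \<bar>\<omega>\<bar> / pi" "scale j * \<bar>\<omega>\<bar> / pi < real_of_int p"
    unfolding q_mult_M by (simp_all add: scale_def mult_ac)
  define k where "k = \<lfloor>scale j * \<bar>\<omega>\<bar> / pi\<rfloor>"
  have k: "q \<le> k" "k < p"
    using x by (simp_all add: k_def le_floor_iff floor_less_iff)
  have "real_of_int k \<le> scale j * \<bar>\<omega>\<bar> / pi" "scale j * \<bar>\<omega>\<bar> / pi < real_of_int (k + 1)"
    unfolding k_def by linarith+
  then have "real_of_int k * pi \<le> \<bar>scale j * \<omega>\<bar>" "\<bar>scale j * \<omega>\<bar> < real_of_int (k + 1) * pi"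
    using scale_pos[of j] by (simp_all add: abs_mult pos_le_divide_eq pos_divide_less_eq)
  then have "\<omega> \<in> dilated_band j (k - q + 1)"
    by (simp add: dilated_band_def freq_band_def)
  then show thesis
    using that[of "k - q + 1" j] k by simp
qed

text \<open>The factor \<open>sqrt (scale j)\<close> compensates the dilation, which shrinks a band
  of measure \<open>2 * pi\<close> by the factor \<open>scale j\<close>.\<close>

definition freq_wavelet :: "int \<times> int \<times> int \<Rightarrow> real \<Rightarrow> complex" where
  "freq_wavelet = (\<lambda>(j, n, m) \<omega>. complex_of_real (sqrt (scale j)) *
     (indicator (dilated_band j m) \<omega> * cis (- (real_of_int n * (scale j * \<omega>)))))"

abbreviation wavelet_index :: "(int \<times> int \<times> int) set" where
  "wavelet_index \<equiv> {(j, n, m). 1 \<le> m \<and> m \<le> p - q}"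

text \<open>Different levels or bands have disjoint supports. On a common band the substitution t =
  s \<omega> absorbs the amplitudes and leaves an exponential of frequency n' - n over an undilated
  band.\<close>

lemma freq_wavelet_orthonormal:
  assumes "i \<in> wavelet_index" "i' \<in> wavelet_index"
  shows "L2_inner (freq_wavelet i) (freq_wavelet i') = (if i = i' then 2 * pi else 0)"
proof -
  obtain j n m j' n' m' where i: "i = (j, n, m)" "i' = (j', n', m')"
    by (metis prod.exhaust)
  have m: "1 \<le> m" "m \<le> p - q" "1 \<le> m'" "m' \<le> p - q"
    using assms by (auto simp: i)
  show ?thesis
  proof (cases "j = j' \<and> m = m'")
    case False
    then have zero: "freq_wavelet i \<omega> * cnj (freq_wavelet i' \<omega>) = 0" for \<omega>
      using dilated_band_unique[OF _ m(1,2) _ m(3,4)] by (auto simp: i freq_wavelet_def indicator_def)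
    have "L2_inner (freq_wavelet i) (freq_wavelet i') = 0"
      unfolding L2_inner_def zero by simp
    then show ?thesis
      using False by (auto simp: i)
  next
    case True
    have prod: "freq_wavelet i \<omega> * cnj (freq_wavelet i' \<omega>)
        = scale j *\<^sub>R (indicator (freq_band (q + m - 1)) (0 + scale j * \<omega>) *\<^sub>R cis (real_of_int (n' - n) * (0 + scale j * \<omega>)))" for \<omega>
    proof (cases "\<omega> \<in> dilated_band j m")
      case in_band: True
      have "complex_of_real (sqrt (scale j)) * complex_of_real (sqrt (scale j)) = complex_of_real (scale j)"
        using scale_pos[of j] by (simp flip: of_real_mult)
      moreover have "cis (- (real_of_int n * (scale j * \<omega>))) * cis (real_of_int n' * (scale j * \<omega>))
          = cis (real_of_int (n' - n) * (scale j * \<omega>))"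
        by (simp add: cis_mult algebra_simps)
      ultimately show ?thesis
        using in_band True
        by (simp add: i freq_wavelet_def dilated_band_def cis_cnj scaleR_conv_of_real mult_ac)
    qed (use True in \<open>auto simp: i freq_wavelet_def dilated_band_def\<close>)
    have "L2_inner (freq_wavelet i) (freq_wavelet i')
       = \<bar>scale j\<bar> *\<^sub>R (LINT \<omega>|lborel. indicator (freq_band (q + m - 1)) (0 + scale j * \<omega>) *\<^sub>R cis (real_of_int (n' - n) * (0 + scale j * \<omega>)))"
      unfolding L2_inner_def prod integral_scaleR_right using scale_pos[of j] by simp
    also have "\<dots> = (LINT t|lborel. indicator (freq_band (q + m - 1)) t *\<^sub>R cis (real_of_int (n' - n) * t))"
      using scale_pos[of j] by (intro lborel_integral_real_affine[symmetric]) auto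
    also have "\<dots> = (if n' - n = 0 then 2 * pi else 0)"
      using pq m by (intro integral_freq_band_cis) auto
    finally show ?thesis
      using True by (auto simp: i)
  qed
qed

lemma freq_wavelet_approx_band:
  assumes g: "g \<in> L2" and m: "1 \<le> m" "m \<le> p - q"
  shows "L2_approximable wavelet_index freq_wavelet (\<lambda>\<omega>. indicator (dilated_band j m) \<omega> * g \<omega>)"
  unfolding L2_approximable_def
proof (intro allI impI)
  fix \<epsilon> :: real
  assume \<epsilon>: "\<epsilon> > 0"
  define s where "s = scale j"
  \<comment> \<open>Since q and m are at least 1, k is at least 1, so the undilated band stays away
    from 0 and the translation argument applies.\<close>
  define k where "k = q + m - 1"
  have s: "s > 0"
    by (simp add: s_def scale_pos)
  have [measurable]: "g \<in> borel_measurable borel"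
    using g by (rule L2_measurable)
  define h where "h = (\<lambda>t. indicator (freq_band k) t * g (t / s))"
  have "h \<in> L2"
    unfolding h_def
    by (rule L2_bound[OF _ L2_affine[OF g, of "1 / s" 0]]) (use s in \<open>auto simp: indicator_def\<close>)
  moreover have "k \<ge> 1" "\<And>t. t \<notin> freq_band k \<Longrightarrow> h t = 0" "\<epsilon> * sqrt s > 0"
    using pq m s \<epsilon> by (auto simp: k_def h_def)
  ultimately obtain P where P: "trig_poly P" "L2_norm (\<lambda>t. h t - indicator (freq_band k) t * P t) < \<epsilon> * sqrt s"
    using freq_band_trig_approx[of k h "\<epsilon> * sqrt s"] by blast
  obtain A c where A: "finite A" "P = (\<lambda>t. \<Sum>n\<in>A. c n * cis (real_of_int n * t))"
    using P(1) by (auto simp: trig_poly_def)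
  \<comment> \<open>The wavelet of index n carries frequency -n, hence the sign change in the
    indices and in the coefficients, which also divide out the amplitude.\<close>
  define B where "B = (\<lambda>n. (j, -n, m)) ` A"
  define d where "d = (\<lambda>(j :: int, n, m :: int). c (-n) / complex_of_real (sqrt s))"
  have inj: "inj_on (\<lambda>n. (j, -n, m)) A"
    by (auto simp: inj_on_def)
  have "(\<Sum>i\<in>B. d i * freq_wavelet i \<omega>) = indicator (freq_band k) (s * \<omega>) * P (s * \<omega>)" for \<omega>
    unfolding B_def sum.reindex[OF inj] A sum_distrib_left using s
    by (intro sum.cong refl)
       (simp add: d_def freq_wavelet_def dilated_band_def s_def k_def indicator_def)
  then have "L2_norm (\<lambda>\<omega>. indicator (dilated_band j m) \<omega> * g \<omega> - (\<Sum>i\<in>B. d i * freq_wavelet i \<omega>))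
      = L2_norm (\<lambda>\<omega>. (\<lambda>t. h t - indicator (freq_band k) t * P t) (0 + s * \<omega>))"
    using s by (intro arg_cong[of _ _ L2_norm])
      (simp add: fun_eq_iff h_def dilated_band_def k_def s_def[symmetric] indicator_def)
  also have "\<dots> = L2_norm (\<lambda>t. h t - indicator (freq_band k) t * P t) / sqrt \<bar>s\<bar>"
    using s by (intro L2_norm_affine) simp
  also have "\<dots> < \<epsilon>"
    using P(2) s by (simp add: pos_divide_less_eq)
  finally show "\<exists>A c. finite A \<and> A \<subseteq> wavelet_index \<and>
      L2_norm (\<lambda>\<omega>. indicator (dilated_band j m) \<omega> * g \<omega> - (\<Sum>i\<in>A. c i * freq_wavelet i \<omega>)) < \<epsilon>"
    using A m by (intro exI[of _ B] exI[of _ d]) (auto simp: B_def)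
qed

lemma freq_wavelet_L2:
  assumes "i \<in> wavelet_index"
  shows "freq_wavelet i \<in> L2"
proof -
  obtain j n m where i: "i = (j, n, m)"
    by (metis prod.exhaust)
  have "(\<lambda>t. indicator (freq_band (q + m - 1)) t * (1 * cis (real_of_int (-n) * t))) \<in> L2"
    by (intro indicator_trig_poly_L2[OF trig_poly_monomial _ freq_band_subset]) measurable
  from L2_cmult[OF L2_affine[OF this, of "scale j" 0], of "complex_of_real (sqrt (scale j))"]
  show ?thesis
    using scale_pos[of j] by (simp add: i freq_wavelet_def dilated_band_def indicator_def)
qed

lemma freq_wavelet_dense:
  assumes g: "g \<in> L2"
  shows "L2_approximable wavelet_index freq_wavelet g"
proof -
  \<comment> \<open>Levels up to N in absolute value with all generators: finitely many disjoint
    bands, whose union eventually contains any given nonzero frequency. Translations are absent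
    because each single band is already handled with all of them.\<close>
  define K where "K = (\<lambda>N::nat. {- int N..int N} \<times> {1..p - q})"
  define U where "U = (\<lambda>N. \<Union>(j, m)\<in>K N. dilated_band j m)"
  define F where "F = (\<lambda>N \<omega>. indicator (U N) \<omega> * g \<omega>)"
  have [measurable]: "g \<in> borel_measurable borel" "U N \<in> sets borel" for N
    using g by (auto simp: U_def K_def intro: L2_measurable)
  have lim: "L2_tendsto F g"
  proof (rule L2_tendstoI_dominated[where w = g])
    show "AE \<omega> in lborel. (\<lambda>N. F N \<omega>) \<longlonglongrightarrow> g \<omega>"
      using AE_lborel_singleton[of 0]
    proof eventually_elim
      case (elim \<omega>)
      then obtain j m where jm: "1 \<le> m" "m \<le> p - q" "\<omega> \<in> dilated_band j m"
        using dilated_band_cover by blast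
      have "F N \<omega> = g \<omega>" if "N \<ge> nat \<bar>j\<bar>" for N
      proof -
        have "(j, m) \<in> K N"
          using that jm by (auto simp: K_def)
        then have "\<omega> \<in> U N"
          using jm(3) by (auto simp: U_def)
        then show ?thesis
          by (simp add: F_def)
      qed
      then show ?case
        by (intro tendsto_eventually eventually_sequentiallyI)
    qed
  qed (use g in \<open>auto simp: F_def indicator_def\<close>)
  have approx: "L2_approximable wavelet_index freq_wavelet (F N)" for N
  proof -
    have "disjoint_family_on (\<lambda>(j, m). dilated_band j m) (K N)"
      using dilated_band_unique by (auto simp: disjoint_family_on_def K_def)
    then have "indicator (U N) \<omega> = (\<Sum>(j, m)\<in>K N. indicator (dilated_band j m) \<omega> :: complex)" for \<omega>
      unfolding U_def by (subst indicator_UN_disjoint) (auto simp: K_def case_prod_unfold)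
    then have F: "F N = (\<lambda>\<omega>. \<Sum>i\<in>K N. indicator (dilated_band (fst i) (snd i)) \<omega> * g \<omega>)"
      by (simp add: F_def sum_distrib_right case_prod_unfold)
    show ?thesis
      unfolding F
    proof (rule L2_approximable_sum[OF freq_wavelet_L2])
      fix i assume i: "i \<in> K N"
      show "(\<lambda>\<omega>. indicator (dilated_band (fst i) (snd i)) \<omega> * g \<omega>) \<in> L2"
        by (rule L2_bound[OF _ g]) (auto simp: indicator_def)
      show "L2_approximable wavelet_index freq_wavelet (\<lambda>\<omega>. indicator (dilated_band (fst i) (snd i)) \<omega> * g \<omega>)"
        using i by (intro freq_wavelet_approx_band g) (auto simp: K_def)
    qed auto
  qed
  show ?thesis
    by (rule L2_approximable_limit[OF freq_wavelet_L2 lim approx])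
qed

lemma has_fourier_L2_freq_wavelet:
  assumes "has_fourier_L2 f
      (\<lambda>\<omega>. if real_of_int (q + m - 1) * (pi / real_of_int q) \<le> \<bar>\<omega>\<bar> \<and>
                \<bar>\<omega>\<bar> < real_of_int (q + m) * (pi / real_of_int q)
             then complex_of_real (sqrt (real_of_int q)) else 0)"
  shows "has_fourier_L2 (\<lambda>x. complex_of_real (M powr (- (real_of_int j / 2))) *
      f (M powi (- j) * x - real_of_int (n * q))) (freq_wavelet (j, n, m))"
proof -
  define a where "a = M powi (- j)"
  have a: "a > 0" and inv_a: "1 / a = M powi j"
    using M_gt_1 by (simp_all add: a_def power_int_minus divide_inverse)
  have q: "real_of_int q > 0"
    using pq by simp
  have band: "real_of_int (q + m - 1) * (pi / real_of_int q) \<le> \<bar>\<omega> / a\<bar> \<and>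
      \<bar>\<omega> / a\<bar> < real_of_int (q + m) * (pi / real_of_int q) \<longleftrightarrow> \<omega> \<in> dilated_band j m" for \<omega>
  proof -
    have "\<bar>\<omega> / a\<bar> = \<bar>\<omega>\<bar> * M powi j"
      unfolding inv_a[symmetric] using a by simp
    moreover have "\<bar>scale j * \<omega>\<bar> = real_of_int q * (\<bar>\<omega>\<bar> * M powi j)"
      using q M_gt_1 by (simp add: scale_def abs_mult)
    ultimately show ?thesis
      using q by (simp add: dilated_band_def freq_band_def pos_divide_le_eq pos_less_divide_eq mult_ac)
  qed
  \<comment> \<open>The three factors are the normalisation of the wavelet, the Jacobian 1 / a of
    its dilation and the height of the generator.\<close>
  have amp: "M powr (- (real_of_int j / 2)) * M powi j * sqrt (real_of_int q) = sqrt (scale j)"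
  proof -
    have "M powr (- (real_of_int j / 2)) * M powi j = M powr (real_of_int j / 2)"
      using M_gt_1 by (simp add: powr_real_of_int'[symmetric] flip: powr_add)
    also have "\<dots> = sqrt (M powi j)"
      using M_gt_1 by (simp add: powr_real_of_int'[symmetric] powr_half_sqrt[symmetric] powr_powr)
    finally show ?thesis
      by (simp add: scale_def real_sqrt_mult)
  qed
  \<comment> \<open>Here the translation step q merges with the dilation factor 1 / a = M^j into the
    scale.\<close>
  have phase: "\<omega> * real_of_int (n * q) / a = real_of_int n * (scale j * \<omega>)" for \<omega>
    unfolding scale_def inv_a[symmetric] by (simp add: mult_ac)
  have "complex_of_real (M powr (- (real_of_int j / 2))) * (complex_of_real (1 / a) *
      (cis (- (\<omega> * real_of_int (n * q) / a)) *
        (if real_of_int (q + m - 1) * (pi / real_of_int q) \<le> \<bar>\<omega> / a\<bar> \<and>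
                \<bar>\<omega> / a\<bar> < real_of_int (q + m) * (pi / real_of_int q)
             then complex_of_real (sqrt (real_of_int q)) else 0)))
      = freq_wavelet (j, n, m) \<omega>" for \<omega>
    unfolding band phase inv_a by (simp add: freq_wavelet_def amp[symmetric] indicator_def)
  with has_fourier_L2_cmult[OF has_fourier_L2_affine[OF assms a, of "real_of_int (n * q)"],
      of "complex_of_real (M powr (- (real_of_int j / 2)))"]
  show ?thesis
    unfolding a_def by simp
qed

end

theorem theorem2:
  fixes p q :: int and M :: real and \<psi> :: "int \<Rightarrow> real \<Rightarrow> complex"
  assumes "coprime p q" and "p > q" and "q \<ge> 1"
    and "M = real_of_int p / real_of_int q"
    and "\<And>m. 1 \<le> m \<Longrightarrow> m \<le> p - q \<Longrightarrow> \<psi> m \<in> L2"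
    and "\<And>m. 1 \<le> m \<Longrightarrow> m \<le> p - q \<Longrightarrow>
      has_fourier_L2 (\<psi> m)
        (\<lambda>\<omega>. if real_of_int (q + m - 1) * (pi / real_of_int q) \<le> \<bar>\<omega>\<bar> \<and>
                \<bar>\<omega>\<bar> < real_of_int (q + m) * (pi / real_of_int q)
             then complex_of_real (sqrt (real_of_int q)) else 0)"
  shows "orthonormal_basis_L2 {(j :: int, n :: int, m :: int). 1 \<le> m \<and> m \<le> p - q}
    (\<lambda>(j, n, m) x. complex_of_real (M powr (- (real_of_int j / 2))) *
                   \<psi> m (M powi (- j) * x - real_of_int (n * q)))"
proof -
  interpret rational_dilation p q M
    using assms(2-4) by unfold_locales
  show ?thesis
    by (rule orthonormal_basis_L2_fourier[of _ _ freq_wavelet])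
       (use has_fourier_L2_freq_wavelet[OF assms(6)] freq_wavelet_orthonormal freq_wavelet_dense in auto)
qed

end
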